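(* Let $G$ be a connected Lie group. Any special connection $\nabla$ on $G$ is semi-symmetric, i.e. its curvature tensor $K$ satisfies $$\nabla_X\nabla_YK-\nabla_Y\nabla_XK-\nabla_{[X,Y]}K=0$$ for all vector fields $X,Y$ on $G$.
   Context: Let $\mathfrak{g}=T_eG$, and for $u\in\mathfrak{g}$ let $u^+$ be the left invariant vector field with $u^+(e)=u$. Let $\nabla^0$ be the left invariant linear connection on $G$ given by $\nabla^0_{u^+}v^+=\frac12[u^+,v^+]$. A linear connection on $G$ is bi-invariant if it is invariant under all left and all right multiplications. The curvature is $K^\nabla(X,Y)=[\nabla_X,\nabla_Y]-\nabla_{[X,Y]}$. A special connection on $G$ is a torsion free bi-invariant linear connection on $G$ which has the same curvature as $\nabla^0$. *)

theory Defs
  imports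
    "HOL-Analysis.Analysis"
    "HOL-Algebra.Group"
    "HOL-Library.Function_Algebras"
begin

section \<open>Smooth maps between open subsets of Euclidean spaces\<close>

text \<open>
  Euclidean spaces are finite-dimensional types of class \<^class>\<open>real_inner\<close>. The class
  \<^class>\<open>euclidean_space\<close> is not used because it excludes dimension zero.
\<close>

primrec Ck_on :: "nat \<Rightarrow> ('e::real_inner \<Rightarrow> 'f::real_inner) \<Rightarrow> 'e set \<Rightarrow> bool" where
  "Ck_on 0 f S \<longleftrightarrow> continuous_on S f"
| "Ck_on (Suc k) f S \<longleftrightarrow>
     (\<forall>x\<in>S. f differentiable (at x)) \<and>
     (\<forall>v. Ck_on k (\<lambda>x. frechet_derivative f (at x) v) S)"

definition smooth_on :: "('e::real_inner \<Rightarrow> 'f::real_inner) \<Rightarrow> 'e set \<Rightarrow> bool" where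
  "smooth_on f S \<longleftrightarrow> (\<forall>k. Ck_on k f S)"


section \<open>Smooth manifolds and Lie groups\<close>

text \<open>
  The underlying set of a manifold is a whole topological type. A chart is a pair of an open
  domain and a coordinate map, of which only the values on the domain matter. Atlases are not
  required to be maximal.
\<close>

type_synonym ('a, 'e) atlas = "('a set \<times> ('a \<Rightarrow> 'e)) set"

definition is_chart :: "'a::topological_space set \<times> ('a \<Rightarrow> 'e::real_inner) \<Rightarrow> bool" where
  "is_chart c \<longleftrightarrow> (case c of (U, \<phi>) \<Rightarrow>
     open U \<and> open (\<phi> ` U) \<and> homeomorphism U (\<phi> ` U) \<phi> (inv_into U \<phi>))"

locale smooth_manifold =
  fixes A :: "('a::{t2_space,second_countable_topology}, 'e::real_inner) atlas"
  assumes finite_dim: "\<exists>B::'e set. finite B \<and> span B = UNIV"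
    and charts: "c \<in> A \<Longrightarrow> is_chart c"
    and cover: "(\<Union>(U, \<phi>)\<in>A. U) = UNIV"
    and compatible: "\<lbrakk>(U, \<phi>) \<in> A; (V, \<psi>) \<in> A\<rbrakk> \<Longrightarrow>
      smooth_on (\<psi> \<circ> inv_into U \<phi>) (\<phi> ` (U \<inter> V))"

definition smooth_map ::
    "('a::topological_space, 'e::real_inner) atlas \<Rightarrow> ('b::topological_space, 'f::real_inner) atlas
      \<Rightarrow> ('a \<Rightarrow> 'b) \<Rightarrow> bool" where
  "smooth_map A B f \<longleftrightarrow> continuous_on UNIV f \<and>
     (\<forall>(U, \<phi>)\<in>A. \<forall>(V, \<psi>)\<in>B. smooth_on (\<psi> \<circ> f \<circ> inv_into U \<phi>) (\<phi> ` (U \<inter> f -` V)))"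

definition prod_atlas ::
    "('a, 'e) atlas \<Rightarrow> ('b, 'f) atlas \<Rightarrow> ('a \<times> 'b, 'e \<times> 'f) atlas" where
  "prod_atlas A B = {(U \<times> V, map_prod \<phi> \<psi>) | U \<phi> V \<psi>. (U, \<phi>) \<in> A \<and> (V, \<psi>) \<in> B}"

definition real_atlas :: "(real, real) atlas" where
  "real_atlas = {(UNIV, \<lambda>x. x)}"

locale lie_group = smooth_manifold A + group G
  for A :: "('a::{t2_space,second_countable_topology}, 'e::real_inner) atlas"
    and G :: "('a, 'm) monoid_scheme" (structure) +
  assumes carrier_UNIV: "carrier G = UNIV"
    and smooth_mult: "smooth_map (prod_atlas A A) A (\<lambda>(x, y). x \<otimes> y)"
    and smooth_inv: "smooth_map A A (\<lambda>x. inv x)"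


section \<open>Tangent vectors and vector fields\<close>

definition smooth_fun :: "('a::topological_space, 'e::real_inner) atlas \<Rightarrow> ('a \<Rightarrow> real) set" where
  "smooth_fun A = {f. smooth_map A real_atlas f}"

text \<open>
  Tangent vectors at \<open>p\<close> are the derivations at \<open>p\<close> of the algebra of smooth real functions.
  They are set to \<open>0\<close> on all other functions, so that equality of tangent vectors is equality
  of functionals. Sums, products and differences of functions, and of functionals, are pointwise.
\<close>

definition tangent_space ::
    "('a::topological_space, 'e::real_inner) atlas \<Rightarrow> 'a \<Rightarrow> (('a \<Rightarrow> real) \<Rightarrow> real) set" where
  "tangent_space A p = {v.
     (\<forall>f\<in>smooth_fun A. \<forall>g\<in>smooth_fun A.
        v (f + g) = v f + v g \<and> v (f * g) = v f * g p + f p * v g) \<and>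
     (\<forall>f\<in>smooth_fun A. \<forall>c. v (\<lambda>x. c * f x) = c * v f) \<and>
     (\<forall>f. f \<notin> smooth_fun A \<longrightarrow> v f = 0)}"

type_synonym 'a vfield = "'a \<Rightarrow> ('a \<Rightarrow> real) \<Rightarrow> real"

definition vector_fields :: "('a::topological_space, 'e::real_inner) atlas \<Rightarrow> 'a vfield set" where
  "vector_fields A = {X. (\<forall>p. X p \<in> tangent_space A p) \<and>
     (\<forall>f\<in>smooth_fun A. (\<lambda>p. X p f) \<in> smooth_fun A)}"

definition scale_field :: "('a \<Rightarrow> real) \<Rightarrow> 'a vfield \<Rightarrow> 'a vfield" where
  "scale_field f X = (\<lambda>p h. f p * X p h)"

definition lie_bracket :: "'a vfield \<Rightarrow> 'a vfield \<Rightarrow> 'a vfield" where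
  "lie_bracket X Y = (\<lambda>p f. X p (\<lambda>q. Y q f) - Y p (\<lambda>q. X q f))"

text \<open>
  The differential of a smooth self-map of the manifold; for non-smooth \<open>f\<close> the value is \<open>0\<close>,
  even if \<open>f \<circ> \<phi>\<close> happens to be smooth.
\<close>

definition differential ::
    "('a::topological_space, 'e::real_inner) atlas \<Rightarrow> ('a \<Rightarrow> 'a)
      \<Rightarrow> (('a \<Rightarrow> real) \<Rightarrow> real) \<Rightarrow> (('a \<Rightarrow> real) \<Rightarrow> real)" where
  "differential A \<phi> v = (\<lambda>f. if f \<in> smooth_fun A then v (f \<circ> \<phi>) else 0)"

text \<open>Push-forward of vector fields, for diffeomorphisms \<open>\<phi>\<close> only.\<close>

definition pushforward ::
    "('a::topological_space, 'e::real_inner) atlas \<Rightarrow> ('a \<Rightarrow> 'a) \<Rightarrow> 'a vfield \<Rightarrow> 'a vfield" where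
  "pushforward A \<phi> X = (\<lambda>p. differential A \<phi> (X (inv_into UNIV \<phi> p)))"


section \<open>Linear connections\<close>

text \<open>
  A connection \<open>D\<close> is an operation on vector fields, \<open>D X Y\<close> being the covariant
  derivative of \<open>Y\<close> along \<open>X\<close>. Its values outside \<^const>\<open>vector_fields\<close> are irrelevant.
\<close>

type_synonym 'a connection = "'a vfield \<Rightarrow> 'a vfield \<Rightarrow> 'a vfield"

definition linear_connection ::
    "('a::topological_space, 'e::real_inner) atlas \<Rightarrow> 'a connection \<Rightarrow> bool" where
  "linear_connection A D \<longleftrightarrow>
     (\<forall>X\<in>vector_fields A. \<forall>Y\<in>vector_fields A. D X Y \<in> vector_fields A) \<and>
     (\<forall>X\<in>vector_fields A. \<forall>X'\<in>vector_fields A. \<forall>Y\<in>vector_fields A.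
        D (X + X') Y = D X Y + D X' Y) \<and>
     (\<forall>f\<in>smooth_fun A. \<forall>X\<in>vector_fields A. \<forall>Y\<in>vector_fields A.
        D (scale_field f X) Y = scale_field f (D X Y)) \<and>
     (\<forall>X\<in>vector_fields A. \<forall>Y\<in>vector_fields A. \<forall>Y'\<in>vector_fields A.
        D X (Y + Y') = D X Y + D X Y') \<and>
     (\<forall>f\<in>smooth_fun A. \<forall>X\<in>vector_fields A. \<forall>Y\<in>vector_fields A.
        D X (scale_field f Y) = scale_field (\<lambda>p. X p f) Y + scale_field f (D X Y))"

definition torsion_free ::
    "('a::topological_space, 'e::real_inner) atlas \<Rightarrow> 'a connection \<Rightarrow> bool" where
  "torsion_free A D \<longleftrightarrow>
     (\<forall>X\<in>vector_fields A. \<forall>Y\<in>vector_fields A. D X Y - D Y X = lie_bracket X Y)"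

definition curvature :: "'a connection \<Rightarrow> 'a vfield \<Rightarrow> 'a vfield \<Rightarrow> 'a vfield \<Rightarrow> 'a vfield" where
  "curvature D X Y Z = D X (D Y Z) - D Y (D X Z) - D (lie_bracket X Y) Z"

text \<open>Covariant derivative along \<open>X\<close> of a tensor field \<open>T\<close> of type \<open>(1,3)\<close>.\<close>

definition cov_deriv ::
    "'a connection \<Rightarrow> 'a vfield \<Rightarrow> ('a vfield \<Rightarrow> 'a vfield \<Rightarrow> 'a vfield \<Rightarrow> 'a vfield)
      \<Rightarrow> ('a vfield \<Rightarrow> 'a vfield \<Rightarrow> 'a vfield \<Rightarrow> 'a vfield)" where
  "cov_deriv D X T = (\<lambda>U V W.
     D X (T U V W) - T (D X U) V W - T U (D X V) W - T U V (D X W))"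

definition semi_symmetric ::
    "('a::topological_space, 'e::real_inner) atlas \<Rightarrow> 'a connection \<Rightarrow> bool" where
  "semi_symmetric A D \<longleftrightarrow> (let K = curvature D in
     \<forall>X\<in>vector_fields A. \<forall>Y\<in>vector_fields A.
     \<forall>U\<in>vector_fields A. \<forall>V\<in>vector_fields A. \<forall>W\<in>vector_fields A.
       (cov_deriv D X (cov_deriv D Y K) - cov_deriv D Y (cov_deriv D X K)
         - cov_deriv D (lie_bracket X Y) K) U V W = 0)"

definition connection_invariant ::
    "('a::topological_space, 'e::real_inner) atlas \<Rightarrow> ('a \<Rightarrow> 'a) \<Rightarrow> 'a connection \<Rightarrow> bool" where
  "connection_invariant A \<phi> D \<longleftrightarrow>
     (\<forall>X\<in>vector_fields A. \<forall>Y\<in>vector_fields A.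
        pushforward A \<phi> (D X Y) = D (pushforward A \<phi> X) (pushforward A \<phi> Y))"


section \<open>Special connections on a Lie group\<close>

definition left_invariant_connection ::
    "('a::topological_space, 'e::real_inner) atlas \<Rightarrow> ('a, 'm) monoid_scheme
      \<Rightarrow> 'a connection \<Rightarrow> bool" where
  "left_invariant_connection A G D \<longleftrightarrow> (\<forall>g. connection_invariant A (\<lambda>x. g \<otimes>\<^bsub>G\<^esub> x) D)"

definition right_invariant_connection ::
    "('a::topological_space, 'e::real_inner) atlas \<Rightarrow> ('a, 'm) monoid_scheme
      \<Rightarrow> 'a connection \<Rightarrow> bool" where
  "right_invariant_connection A G D \<longleftrightarrow> (\<forall>g. connection_invariant A (\<lambda>x. x \<otimes>\<^bsub>G\<^esub> g) D)"

definition bi_invariant_connection ::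
    "('a::topological_space, 'e::real_inner) atlas \<Rightarrow> ('a, 'm) monoid_scheme
      \<Rightarrow> 'a connection \<Rightarrow> bool" where
  "bi_invariant_connection A G D \<longleftrightarrow>
     left_invariant_connection A G D \<and> right_invariant_connection A G D"

text \<open>
  \<open>left_inv_field A G u\<close> is the field \<open>u\<^sup>+\<close> whose value at \<open>g\<close> is the image of \<open>u\<close> under the
  differential at the identity of left multiplication by \<open>g\<close>.
\<close>

definition left_inv_field ::
    "('a::topological_space, 'e::real_inner) atlas \<Rightarrow> ('a, 'm) monoid_scheme
      \<Rightarrow> (('a \<Rightarrow> real) \<Rightarrow> real) \<Rightarrow> 'a vfield" where
  "left_inv_field A G u = (\<lambda>g. differential A (\<lambda>x. g \<otimes>\<^bsub>G\<^esub> x) u)"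

text \<open>
  This predicate determines the connection \<open>\<nabla>\<^sup>0\<close> uniquely on vector fields, because the left
  invariant fields form a global frame.
\<close>

definition is_nabla0 ::
    "('a::topological_space, 'e::real_inner) atlas \<Rightarrow> ('a, 'm) monoid_scheme
      \<Rightarrow> 'a connection \<Rightarrow> bool" where
  "is_nabla0 A G D \<longleftrightarrow> linear_connection A D \<and> left_invariant_connection A G D \<and>
     (\<forall>u\<in>tangent_space A \<one>\<^bsub>G\<^esub>. \<forall>v\<in>tangent_space A \<one>\<^bsub>G\<^esub>.
        D (left_inv_field A G u) (left_inv_field A G v) =
          scale_field (\<lambda>_. 1/2) (lie_bracket (left_inv_field A G u) (left_inv_field A G v)))"

definition special_connection ::
    "('a::topological_space, 'e::real_inner) atlas \<Rightarrow> ('a, 'm) monoid_scheme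
      \<Rightarrow> 'a connection \<Rightarrow> bool" where
  "special_connection A G D \<longleftrightarrow>
     linear_connection A D \<and> torsion_free A D \<and> bi_invariant_connection A G D \<and>
     (\<exists>D0. is_nabla0 A G D0 \<and>
        (\<forall>X\<in>vector_fields A. \<forall>Y\<in>vector_fields A. \<forall>Z\<in>vector_fields A.
           curvature D X Y Z = curvature D0 X Y Z))"

end

theory Submission
  imports Defs
begin

text \<open>
  By the Ricci identity the left hand side is \<open>K(X, Y)\<close> acting as a derivation on the tensor \<open>K\<close>,
  so the claim depends only on \<open>K\<close>, which is the curvature of \<open>\<nabla>\<^sup>0\<close>. On left invariant fields
  \<open>K(u, v) w = - [[u, v], w] / 4\<close>, so \<open>K(u, v)\<close> is a multiple of the inner derivation \<open>ad [u, v]\<close>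
  of the Lie algebra and kills \<open>K\<close> by the Jacobi identity. As \<open>K\<close> is tensorial, it remains to
  write every vector field as a finite combination of left invariant fields with smooth
  coefficients. These coefficients are \<open>a\<^sub>b(g) = X\<^sub>g (x \<mapsto> \<zeta>\<^sub>b (g\<inverse> x))\<close>, where the differentials of the
  functions \<open>\<zeta>\<^sub>b\<close> at the identity are the coordinates of a tangent vector. That derivations are given by
  directional derivatives, on which the smoothness of \<open>a\<^sub>b\<close> rests, comes from Hadamard's lemma.
\<close>

section \<open>Calculus of smooth maps\<close>

text \<open>Left translation trivialises the tangent bundle globally, so linearity over the smooth
  functions on all of \<open>G\<close> suffices to pass from left invariant fields to arbitrary
  ones; neither a connection nor \<open>K\<close> is ever restricted to an open set. The obstacle
  sits in the coefficients \<open>a\<^sub>b\<close>: as \<open>g\<close> varies, so does the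
  function \<open>x \<mapsto> \<zeta>\<^sub>b (g\<inverse> x)\<close> that is differentiated,
  whereas smoothness of \<open>X\<close> only speaks of its values on one fixed function. Hence a
  derivation has to be expanded near a point as a sum of partial derivatives whose coefficients are
  built from its values on finitely many global functions, chosen once for the whole neighbourhood.
  Since derivations act here on globally defined functions, with no locality built in, the expansion
  must come from an identity between global functions, which is where bump functions enter. In the
  Ricci identity the commutator of covariant derivatives kills all mixed terms, so that each
  argument of \<open>K\<close>, and its value, is hit by one curvature operator.\<close>

lemma Ck_on_cong:
  assumes "open S" "\<And>x. x \<in> S \<Longrightarrow> f x = g x"
  shows "Ck_on k f S \<longleftrightarrow> Ck_on k g S"
  using assms(2)
proof (induction k arbitrary: f g)
  case 0
  then show ?case by (simp cong: continuous_on_cong_simp)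
next
  case (Suc k)
  \<comment> \<open>\<open>Ck_on\<close> uses the derivative \<open>at x\<close> in the whole space,
    so agreement on the open set \<open>S\<close> is enough; \<open>frechet_derivative\<close> is a
    choice among the derivatives and therefore agrees as well.\<close>
  have der: "(f has_derivative f') (at x) \<longleftrightarrow> (g has_derivative f') (at x)" if "x \<in> S" for x f'
    using Suc.prems has_derivative_transform_within_open[OF _ assms(1) that, of f f' UNIV g]
      has_derivative_transform_within_open[OF _ assms(1) that, of g f' UNIV f] by auto
  have "frechet_derivative f (at x) = frechet_derivative g (at x)" if "x \<in> S" for x
    unfolding frechet_derivative_def using der[OF that] by simp
  then have "Ck_on k (\<lambda>x. frechet_derivative f (at x) v) S \<longleftrightarrow>
      Ck_on k (\<lambda>x. frechet_derivative g (at x) v) S" for v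
    by (intro Suc.IH) simp
  then show ?case
    using der by (auto simp: differentiable_def)
qed

lemma Ck_on_mono: "Ck_on k f T \<Longrightarrow> S \<subseteq> T \<Longrightarrow> Ck_on k f S"
  by (induction k arbitrary: f) (auto intro: continuous_on_subset)

text \<open>Derivatives are unique, so any explicit formula \<open>f'\<close> may stand in for
  \<open>frechet_derivative\<close> on the open set \<open>S\<close>. The closure properties that
  rest on a differentiation rule go through this form.\<close>

lemma Ck_on_SucI:
  assumes "open S" "\<And>x. x \<in> S \<Longrightarrow> (f has_derivative f' x) (at x)"
    and "\<And>v. Ck_on k (\<lambda>x. f' x v) S"
  shows "Ck_on (Suc k) f S"
proof -
  have "Ck_on k (\<lambda>x. frechet_derivative f (at x) v) S \<longleftrightarrow> Ck_on k (\<lambda>x. f' x v) S" for v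
    using assms(1) by (rule Ck_on_cong) (simp add: frechet_derivative_at[OF assms(2), symmetric])
  with assms show ?thesis by (auto simp: differentiable_def)
qed

lemma Ck_on_Suc_imp_has_derivative:
  "Ck_on (Suc k) f S \<Longrightarrow> x \<in> S \<Longrightarrow> (f has_derivative frechet_derivative f (at x)) (at x)"
  by (simp add: frechet_derivative_works)

lemma Ck_on_SucD: "Ck_on (Suc k) f S \<Longrightarrow> Ck_on k f S"
proof (induction k arbitrary: f)
  case 0
  then show ?case
    by (auto intro!: continuous_at_imp_continuous_on differentiable_imp_continuous_within)
next
  case (Suc k)
  have "\<forall>x\<in>S. f differentiable (at x)" "Ck_on (Suc k) (\<lambda>x. frechet_derivative f (at x) v) S" for v
    using Suc.prems unfolding Ck_on.simps(2)[of "Suc k" f] by blast+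
  then show ?case
    unfolding Ck_on.simps(2)[of k f] by (blast intro: Suc.IH)
qed

lemma Ck_on_imp_continuous_on: "Ck_on k f S \<Longrightarrow> continuous_on S f"
  by (induction k) (auto dest: Ck_on_SucD simp del: Ck_on.simps(2))

lemma Ck_on_local:
  assumes "\<And>x. x \<in> S \<Longrightarrow> \<exists>T. open T \<and> x \<in> T \<and> Ck_on k f T"
  shows "Ck_on k f S"
  using assms
proof (induction k arbitrary: f)
  case 0
  show ?case
    unfolding Ck_on.simps
  proof (rule continuous_at_imp_continuous_on, rule ballI)
    fix x assume "x \<in> S"
    then obtain T where "open T" "x \<in> T" "Ck_on 0 f T" using 0 by blast
    then show "isCont f x" by (auto simp: continuous_on_eq_continuous_at)
  qed
next
  case (Suc k)
  have "Ck_on k (\<lambda>x. frechet_derivative f (at x) v) S" for v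
  proof (rule Suc.IH)
    fix x assume "x \<in> S"
    then show "\<exists>T. open T \<and> x \<in> T \<and> Ck_on k (\<lambda>x. frechet_derivative f (at x) v) T"
      using Suc.prems by fastforce
  qed
  moreover have "f differentiable (at x)" if "x \<in> S" for x
    using Suc.prems[OF that] by auto
  ultimately show ?case by simp
qed

lemma Ck_on_const: "Ck_on k (\<lambda>x. c) S"
  by (induction k arbitrary: c) (auto)

lemma Ck_on_linear_comp:
  assumes "bounded_linear L" "open S" "Ck_on k f S"
  shows "Ck_on k (\<lambda>x. L (f x)) S"
  using assms(3)
proof (induction k arbitrary: f)
  case 0
  then show ?case using assms(1) by (auto intro: bounded_linear.continuous_on)
next
  case (Suc k)
  show ?case
  proof (rule Ck_on_SucI[OF assms(2)])
    show "((\<lambda>x. L (f x)) has_derivative (\<lambda>v. L (frechet_derivative f (at x) v))) (at x)"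
      if "x \<in> S" for x
      using bounded_linear.has_derivative[OF assms(1) Ck_on_Suc_imp_has_derivative[OF Suc.prems that]] .
    show "Ck_on k (\<lambda>x. L (frechet_derivative f (at x) v)) S" for v
      using Suc by simp
  qed
qed

lemma Ck_on_linear:
  assumes "bounded_linear L"
  shows "Ck_on k L S"
proof (rule Ck_on_mono[of _ _ UNIV])
  show "Ck_on k L UNIV"
  proof (cases k)
    case 0
    then show ?thesis using assms by (simp add: linear_continuous_on)
  next
    case (Suc m)
    then show ?thesis
      using Ck_on_SucI[of UNIV L "\<lambda>_. L" m] assms bounded_linear_imp_has_derivative Ck_on_const
      by blast
  qed
qed simp

lemma Ck_on_Pair:
  assumes "open S" "Ck_on k f S" "Ck_on k g S"
  shows "Ck_on k (\<lambda>x. (f x, g x)) S"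
  using assms(2,3)
proof (induction k arbitrary: f g)
  case 0
  then show ?case by (auto intro: continuous_on_Pair)
next
  case (Suc k)
  show ?case
  proof (rule Ck_on_SucI[OF assms(1)])
    show "((\<lambda>x. (f x, g x)) has_derivative
        (\<lambda>v. (frechet_derivative f (at x) v, frechet_derivative g (at x) v))) (at x)" if "x \<in> S" for x
      using Suc.prems that by (intro has_derivative_Pair Ck_on_Suc_imp_has_derivative)
    show "Ck_on k (\<lambda>x. (frechet_derivative f (at x) v, frechet_derivative g (at x) v)) S" for v
      using Suc by simp
  qed
qed

lemma Ck_on_add:
  assumes "open S" "Ck_on k f S" "Ck_on k g S"
  shows "Ck_on k (\<lambda>x. f x + g x) S"
  using Ck_on_linear_comp[OF _ assms(1) Ck_on_Pair[OF assms], of "\<lambda>z. fst z + snd z"]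
  by (simp add: bounded_linear_add bounded_linear_fst bounded_linear_snd)

lemma Ck_on_diff:
  assumes "open S" "Ck_on k f S" "Ck_on k g S"
  shows "Ck_on k (\<lambda>x. f x - g x) S"
  using Ck_on_linear_comp[OF _ assms(1) Ck_on_Pair[OF assms], of "\<lambda>z. fst z - snd z"]
  by (simp add: bounded_linear_sub bounded_linear_fst bounded_linear_snd)

lemma Ck_on_sum:
  assumes "open S" "\<And>i. i \<in> I \<Longrightarrow> Ck_on k (f i) S"
  shows "Ck_on k (\<lambda>x. \<Sum>i\<in>I. f i x) S"
  using assms(2)
  by (induction I rule: infinite_finite_induct) (auto intro: Ck_on_const Ck_on_add[OF assms(1)])

text \<open>The product rule yields two products in each of which one factor is differentiated;
  \<open>Ck_on_SucD\<close> lowers the order of the other, and the induction hypothesis applies to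
  both. Products and scalar multiples are instances.\<close>

lemma Ck_on_bilinear:
  fixes f :: "'e::real_inner \<Rightarrow> 'a::real_inner" and g :: "'e \<Rightarrow> 'b::real_inner"
    and h :: "'a \<Rightarrow> 'b \<Rightarrow> 'c::real_inner"
  assumes h: "bounded_bilinear h" and S: "open S" and "Ck_on k f S" "Ck_on k g S"
  shows "Ck_on k (\<lambda>x. h (f x) (g x)) S"
  using assms(3,4)
proof (induction k arbitrary: f g)
  case 0
  then show ?case by (auto intro: bounded_bilinear.continuous_on[OF h])
next
  case (Suc k)
  show ?case
  proof (rule Ck_on_SucI[OF S])
    show "((\<lambda>x. h (f x) (g x)) has_derivative
        (\<lambda>v. h (f x) (frechet_derivative g (at x) v) + h (frechet_derivative f (at x) v) (g x))) (at x)"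
      if "x \<in> S" for x
      using Suc.prems that by (intro bounded_bilinear.FDERIV[OF h] Ck_on_Suc_imp_has_derivative)
    show "Ck_on k (\<lambda>x. h (f x) (frechet_derivative g (at x) v)
        + h (frechet_derivative f (at x) v) (g x)) S" for v
      using Suc.prems Ck_on_SucD[OF Suc.prems(1)] Ck_on_SucD[OF Suc.prems(2)]
      by (intro Ck_on_add[OF S] Suc.IH) auto
  qed
qed

lemmas Ck_on_mult = Ck_on_bilinear[OF bounded_bilinear_mult[where 'a = real]]
lemmas Ck_on_scaleR = Ck_on_bilinear[OF bounded_bilinear_scaleR]

text \<open>The derivative of \<open>1 / f\<close> is again built from \<open>inverse (f x)\<close>
  and the derivative of \<open>f\<close>, so the induction can keep \<open>f\<close> fixed and only
  lower its order.\<close>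

lemma Ck_on_inverse:
  fixes f :: "'e::real_inner \<Rightarrow> real"
  assumes "open S" "Ck_on k f S" "\<And>x. x \<in> S \<Longrightarrow> f x \<noteq> 0"
  shows "Ck_on k (\<lambda>x. inverse (f x)) S"
  using assms(2)
proof (induction k)
  case 0
  then show ?case using assms(3) by (auto intro: continuous_on_inverse)
next
  case (Suc k)
  show ?case
  proof (rule Ck_on_SucI[OF assms(1)])
    show "((\<lambda>x. inverse (f x)) has_derivative
        (\<lambda>v. (- 1) * (inverse (f x) * frechet_derivative f (at x) v * inverse (f x)))) (at x)"
      if "x \<in> S" for x
      using Deriv.has_derivative_inverse[OF assms(3)[OF that] Ck_on_Suc_imp_has_derivative[OF Suc.prems that]]
      by simp
    show "Ck_on k (\<lambda>x. (- 1) * (inverse (f x) * frechet_derivative f (at x) v * inverse (f x))) S" for v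
      using Suc.IH[OF Ck_on_SucD[OF Suc.prems]] Suc.prems
      by (intro Ck_on_mult[OF assms(1)] Ck_on_const) auto
  qed
qed

text \<open>
  Stands in for an orthonormal basis: the class \<^class>\<open>real_inner\<close> does not come with one, and the
  expansion property is all that is used.
\<close>

definition parseval_frame :: "'e::real_inner set \<Rightarrow> bool" where
  "parseval_frame B \<longleftrightarrow> finite B \<and> (\<forall>x. x = (\<Sum>b\<in>B. (x \<bullet> b) *\<^sub>R b))"

lemma parseval_frame_expand: "parseval_frame B \<Longrightarrow> (\<Sum>b\<in>B. (x \<bullet> b) *\<^sub>R b) = x"
  by (simp add: parseval_frame_def)

lemma linear_parseval_frame:
  assumes "parseval_frame B" "linear L"
  shows "L x = (\<Sum>b\<in>B. (x \<bullet> b) *\<^sub>R L b)"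
proof -
  have "L x = L (\<Sum>b\<in>B. (x \<bullet> b) *\<^sub>R b)"
    by (simp add: parseval_frame_expand[OF assms(1)])
  also have "\<dots> = (\<Sum>b\<in>B. (x \<bullet> b) *\<^sub>R L b)"
    using assms(2) by (simp add: linear_sum linear_scale)
  finally show ?thesis .
qed

text \<open>Gram-Schmidt provides a finite orthogonal spanning set; discarding \<open>0\<close> and
  normalising turns it into an orthonormal basis, which is empty in dimension zero.\<close>

lemma parseval_frame_exists:
  fixes C :: "'e::real_inner set"
  assumes "finite C" "span C = UNIV"
  obtains B :: "'e set" where "parseval_frame B"
proof -
  obtain E :: "'e set" where E: "finite E" "span E = UNIV" "pairwise orthogonal E"
    using basis_orthogonal[OF assms(1)] assms(2) by metis
  define F where "F = E - {0}"
  have F: "finite F" "span F = UNIV" "pairwise orthogonal F" "0 \<notin> F"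
    using E by (auto simp: F_def span_delete_0 pairwise_def)
  define B where "B = (\<lambda>x. x /\<^sub>R norm x) ` F"
  have coord: "(\<Sum>x\<in>F. ((y \<bullet> x) / (x \<bullet> x)) *\<^sub>R x) = y" for y
  proof -
    obtain c where c: "y = (\<Sum>x\<in>F. c x *\<^sub>R x)"
      using F(1,2) span_finite[OF F(1)] by auto
    have "y \<bullet> x = c x * (x \<bullet> x)" if "x \<in> F" for x
    proof -
      have "y \<bullet> x = (\<Sum>z\<in>F. c z * (z \<bullet> x))" by (simp add: c inner_sum_left)
      also have "\<dots> = (\<Sum>z\<in>F. if z = x then c x * (x \<bullet> x) else 0)"
        using F(3) that by (intro sum.cong) (auto simp: pairwise_def orthogonal_def)
      finally show ?thesis using that F(1) by simp
    qed
    then have "(\<Sum>x\<in>F. ((y \<bullet> x) / (x \<bullet> x)) *\<^sub>R x) = (\<Sum>x\<in>F. c x *\<^sub>R x)"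
      using F(4) by (intro sum.cong) auto
    then show ?thesis using c by simp
  qed
  \<comment> \<open>The sum over \<open>B\<close> is to be reindexed by \<open>F\<close>. If two
    orthogonal vectors had the same normalisation, that vector would be orthogonal to itself, hence
    zero.\<close>
  have inj: "inj_on (\<lambda>x. x /\<^sub>R norm x) F"
  proof (rule inj_onI, rule ccontr)
    fix x y assume xy: "x \<in> F" "y \<in> F" "x /\<^sub>R norm x = y /\<^sub>R norm y" "x \<noteq> y"
    then have "orthogonal x y" using F(3) by (auto simp: pairwise_def)
    then have "(x /\<^sub>R norm x) \<bullet> (y /\<^sub>R norm y) = 0" by (simp add: orthogonal_def)
    with xy(3) have "x /\<^sub>R norm x = 0" by simp
    then show False using xy(1) F(4) by auto
  qed
  have "(\<Sum>b\<in>B. (y \<bullet> b) *\<^sub>R b) = y" for y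
  proof -
    have "(\<Sum>b\<in>B. (y \<bullet> b) *\<^sub>R b) = (\<Sum>x\<in>F. ((y \<bullet> x) / (x \<bullet> x)) *\<^sub>R x)"
      unfolding B_def sum.reindex[OF inj]
      by (intro sum.cong)
        (auto simp: power2_norm_eq_inner[symmetric] power2_eq_square divide_inverse mult_ac)
    then show ?thesis using coord by simp
  qed
  then show thesis using that[of B] F(1) by (simp add: parseval_frame_def B_def)
qed

text \<open>A frame may contain the zero vector. Removing it from \<open>C\<close> makes the two
  embedded copies disjoint without changing any expansion, so the two sums simply add up.\<close>

lemma parseval_frame_Times:
  assumes "parseval_frame B" "parseval_frame C"
  shows "parseval_frame ((\<lambda>b. (b, 0)) ` B \<union> (\<lambda>c. (0, c)) ` (C - {0}))"
proof -
  have fin: "finite B" "finite C" using assms by (auto simp: parseval_frame_def)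
  have disj: "(\<lambda>b. (b, 0)) ` B \<inter> (\<lambda>c. (0, c)) ` (C - {0}) = {}" by auto
  have inj: "inj_on (\<lambda>b. (b, 0)) B" "inj_on (\<lambda>c. (0, c)) (C - {0})" by (auto intro: inj_onI)
  have C0: "(\<Sum>c\<in>C - {0}. (y \<bullet> c) *\<^sub>R c) = y" for y
    using parseval_frame_expand[OF assms(2), of y] fin
    by (subst (asm) sum.mono_neutral_right[of _ "C - {0}"]) auto
  have "(\<Sum>b\<in>(\<lambda>b. (b, 0)) ` B \<union> (\<lambda>c. (0, c)) ` (C - {0}). (z \<bullet> b) *\<^sub>R b) = z" for z
    using fin disj
    by (cases z) (simp add: sum.union_disjoint sum.reindex[OF inj(1)] sum.reindex[OF inj(2)]
        sum_prod parseval_frame_expand[OF assms(1)] C0 flip: zero_prod_def)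
  then show ?thesis using fin by (simp add: parseval_frame_def)
qed

text \<open>The chain rule gives a derivative whose direction
  \<open>frechet_derivative g (at x) v\<close> depends on \<open>x\<close>, while the induction
  hypothesis speaks of fixed directions. Expanding that direction in \<open>B\<close> leaves
  finitely many products of a scalar coefficient and a derivative of \<open>f\<close> in a fixed
  direction, composed with \<open>g\<close>.\<close>

lemma Ck_on_compose:
  fixes B :: "'f::real_inner set" and f :: "'f \<Rightarrow> 'c::real_inner" and g :: "'e::real_inner \<Rightarrow> 'f"
  assumes B: "parseval_frame B" and S: "open S" and T: "open T" and sub: "g ` S \<subseteq> T"
    and "Ck_on k f T" "Ck_on k g S"
  shows "Ck_on k (\<lambda>x. f (g x)) S"
  using assms(5,6)
proof (induction k arbitrary: f)
  case 0
  then show ?case using sub by (auto intro: continuous_on_compose2)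
next
  case (Suc k)
  show ?case
  proof (rule Ck_on_SucI[OF S])
    fix x assume x: "x \<in> S"
    then have gx: "g x \<in> T" using sub by auto
    note df = Ck_on_Suc_imp_has_derivative[OF Suc.prems(1) gx]
    note dg = Ck_on_Suc_imp_has_derivative[OF Suc.prems(2) x]
    have "((\<lambda>x. f (g x)) has_derivative
        (\<lambda>v. frechet_derivative f (at (g x)) (frechet_derivative g (at x) v))) (at x)"
      using dg df by (rule has_derivative_compose)
    then show "((\<lambda>x. f (g x)) has_derivative
        (\<lambda>v. \<Sum>b\<in>B. (frechet_derivative g (at x) v \<bullet> b) *\<^sub>R frechet_derivative f (at (g x)) b)) (at x)"
      by (subst (asm) linear_parseval_frame[OF B has_derivative_linear[OF df]]) simp
  next
    fix v
    have "Ck_on k (\<lambda>x. frechet_derivative g (at x) v \<bullet> b) S" for b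
      using Suc.prems(2) by (intro Ck_on_linear_comp[OF bounded_linear_inner_left S]) simp
    moreover have "Ck_on k (\<lambda>x. frechet_derivative f (at (g x)) b) S" for b
      using Suc.prems Ck_on_SucD[OF Suc.prems(2)] by (intro Suc.IH) auto
    ultimately show "Ck_on k (\<lambda>x. \<Sum>b\<in>B. (frechet_derivative g (at x) v \<bullet> b)
        *\<^sub>R frechet_derivative f (at (g x)) b) S"
      by (intro Ck_on_sum[OF S] Ck_on_scaleR[OF S])
  qed
qed

section \<open>Hadamard's lemma and bump functions\<close>

text \<open>By the mean value theorem along the segment from \<open>x\<close> to \<open>y\<close>,
  the increment of \<open>f\<close> is the directional derivative along \<open>y - x\<close> at some
  point in between; continuity in the finitely many frame directions makes the derivative there
  close to \<open>df x\<close>. This will turn one-variable differentiation under an integral into a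
  total derivative.\<close>

lemma has_derivative_if_directional:
  fixes f :: "'e::real_inner \<Rightarrow> real"
  assumes B: "parseval_frame (B :: 'e set)" and S: "open S" "x \<in> S"
    and dir: "\<And>y v. y \<in> S \<Longrightarrow> ((\<lambda>t. f (y + t *\<^sub>R v)) has_real_derivative df y v) (at 0)"
    and lin: "\<And>y. y \<in> S \<Longrightarrow> linear (df y)"
    and cont: "\<And>v. continuous_on S (\<lambda>y. df y v)"
  shows "(f has_derivative df x) (at x)"
proof -
  have fin: "finite B" using B by (simp add: parseval_frame_def)
  \<comment> \<open>The frame takes the place of finite dimensionality: a linear functional is
    bounded by its values on \<open>B\<close>. This gives boundedness of \<open>df x\<close> as well
    as the estimate for the difference of two derivatives.\<close>
  have bound: "\<bar>L v\<bar> \<le> norm v * (\<Sum>b\<in>B. norm b * \<bar>L b\<bar>)" if "linear L" for L :: "'e \<Rightarrow> real" and v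
  proof -
    have "\<bar>L v\<bar> \<le> (\<Sum>b\<in>B. \<bar>(v \<bullet> b) *\<^sub>R L b\<bar>)"
      by (subst linear_parseval_frame[OF B that]) (rule sum_abs)
    also have "\<dots> \<le> (\<Sum>b\<in>B. norm v * (norm b * \<bar>L b\<bar>))"
      by (intro sum_mono)
        (simp add: abs_mult mult.assoc[symmetric] mult_right_mono Cauchy_Schwarz_ineq2)
    finally show ?thesis by (simp add: sum_distrib_left)
  qed
  have blin: "bounded_linear (df x)"
    using lin[OF S(2)] bound[OF lin[OF S(2)]]
    by (intro bounded_linear_intro[where K = "\<Sum>b\<in>B. norm b * \<bar>df x b\<bar>"])
      (auto simp: linear_add linear_scale)
  show ?thesis
    unfolding has_derivative_at_alt
  proof (intro conjI allI impI blin)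
    fix e :: real assume e: "0 < e"
    \<comment> \<open>The summand \<open>1\<close> keeps \<open>K\<close> positive if the frame is
      empty or contains only \<open>0\<close>, and leaves the quotient of the norm sum by
      \<open>K\<close> at most one.\<close>
    define K where "K = (\<Sum>b\<in>B. norm b) + 1"
    have K: "K > 0" unfolding K_def by (simp add: add_nonneg_pos sum_nonneg)
    have "\<forall>\<^sub>F y in nhds x. \<bar>df y b - df x b\<bar> < e / K" for b
    proof -
      have "isCont (\<lambda>y. df y b) x"
        using cont S by (simp add: continuous_on_eq_continuous_at)
      then have "((\<lambda>y. df y b) \<longlongrightarrow> df x b) (nhds x)"
        using tendsto_at_iff_tendsto_nhds[of "\<lambda>y. df y b" x] by (simp add: isCont_def)
      then show ?thesis
        using e K by (auto simp: tendsto_iff dist_real_def)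
    qed
    moreover have "\<forall>\<^sub>F y in nhds x. y \<in> S" using S by (rule eventually_nhds_in_open)
    ultimately have "\<forall>\<^sub>F y in nhds x. y \<in> S \<and> (\<forall>b\<in>B. \<bar>df y b - df x b\<bar> < e / K)"
      using fin by (simp add: eventually_conj_iff eventually_ball_finite)
    then obtain d where d: "d > 0"
      "\<And>y. dist y x < d \<Longrightarrow> y \<in> S \<and> (\<forall>b\<in>B. \<bar>df y b - df x b\<bar> < e / K)"
      by (auto simp: eventually_nhds_metric)
    show "\<exists>d>0. \<forall>y. norm (y - x) < d \<longrightarrow> norm (f y - f x - df x (y - x)) \<le> e * norm (y - x)"
    proof (intro exI conjI allI impI)
      fix y assume y: "norm (y - x) < d"
      define v where "v = y - x"
      have near: "dist (x + t *\<^sub>R v) x < d" if "0 \<le> t" "t \<le> 1" for t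
        using y that mult_left_le_one_le[of "norm v" t] by (simp add: dist_norm v_def)
      have deriv: "((\<lambda>t. f (x + t *\<^sub>R v)) has_real_derivative df (x + t *\<^sub>R v) v) (at t)"
        if "0 \<le> t" "t \<le> 1" for t
      proof -
        have "((\<lambda>s. f ((x + t *\<^sub>R v) + s *\<^sub>R v)) has_real_derivative df (x + t *\<^sub>R v) v) (at 0)"
          using d(2) near that by (intro dir) blast
        then have "((\<lambda>s. (\<lambda>r. f (x + r *\<^sub>R v)) (s + t)) has_real_derivative df (x + t *\<^sub>R v) v) (at 0)"
          by (simp add: algebra_simps)
        then show ?thesis
          using DERIV_shift[of "\<lambda>r. f (x + r *\<^sub>R v)" _ 0 t] by simp
      qed
      obtain z where z: "0 < z" "z < 1"
        "f (x + 1 *\<^sub>R v) - f (x + 0 *\<^sub>R v) = (1 - 0) * df (x + z *\<^sub>R v) v"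
        using MVT2[of 0 1 "\<lambda>t. f (x + t *\<^sub>R v)" "\<lambda>t. df (x + t *\<^sub>R v) v"] deriv by auto
      let ?w = "x + z *\<^sub>R v"
      have w: "?w \<in> S" "\<And>b. b \<in> B \<Longrightarrow> \<bar>df ?w b - df x b\<bar> < e / K"
        using d(2)[OF near[of z]] z by auto
      have "\<bar>df ?w v - df x v\<bar> \<le> norm v * (\<Sum>b\<in>B. norm b * \<bar>df ?w b - df x b\<bar>)"
        using bound[of "\<lambda>v. df ?w v - df x v"] lin[OF w(1)] lin[OF S(2)]
        by (simp add: linear_compose_sub)
      also have "\<dots> \<le> norm v * (\<Sum>b\<in>B. norm b * (e / K))"
        using w(2) by (intro mult_left_mono sum_mono) (auto intro: less_imp_le)
      also have "\<dots> = norm v * (e * ((\<Sum>b\<in>B. norm b) / K))"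
        by (simp flip: sum_distrib_right sum_divide_distrib)
      also have "\<dots> \<le> norm v * (e * 1)"
        using e K by (intro mult_left_mono) (auto simp: K_def)
      finally show "norm (f y - f x - df x (y - x)) \<le> e * norm (y - x)"
        using z(3) by (simp add: v_def mult.commute)
    qed (rule d)
  qed
qed

lemma convex_segment_mem:
  fixes x y :: "'a::real_vector"
  assumes "convex S" "x \<in> S" "y \<in> S" "0 \<le> t" "t \<le> 1"
  shows "x + t *\<^sub>R (y - x) \<in> S"
  using convexD_alt[OF assms(1-3), of t] assms(4,5) by (simp add: algebra_simps)

lemma continuous_on_radial_mean:
  fixes F :: "'e::real_inner \<Rightarrow> real"
  assumes "convex S" "a \<in> S" "continuous_on S F"
  shows "continuous_on S (\<lambda>x. integral {0..1} (\<lambda>t. t ^ m * F (a + t *\<^sub>R (x - a))))"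
proof -
  have "continuous_on (S \<times> cbox 0 1) (\<lambda>(x, t::real). t ^ m * F (a + t *\<^sub>R (x - a)))"
    unfolding case_prod_unfold
    using assms by (intro continuous_intros continuous_on_compose2[OF assms(3)])
      (auto intro!: convex_segment_mem)
  from integral_continuous_on_param[OF this] show ?thesis by simp
qed

text \<open>
  The weight \<open>t ^ m\<close> makes the induction work: differentiating under the integral raises \<open>m\<close> by one.
\<close>

lemma Ck_on_radial_mean:
  fixes F :: "'e::real_inner \<Rightarrow> real"
  assumes B: "parseval_frame (B :: 'e set)" and S: "open S" "convex S" "a \<in> S"
    and "Ck_on k F S"
  shows "Ck_on k (\<lambda>x. integral {0..1} (\<lambda>t. t ^ m * F (a + t *\<^sub>R (x - a)))) S"
  using assms(5)
proof (induction k arbitrary: F m)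
  case 0
  then show ?case using continuous_on_radial_mean[OF S(2,3)] by simp
next
  case (Suc k)
  let ?I = "\<lambda>x. integral {0..1} (\<lambda>t. t ^ m * F (a + t *\<^sub>R (x - a)))"
  let ?dF = "\<lambda>v x. frechet_derivative F (at x) v"
  let ?dI = "\<lambda>x v. integral {0..1} (\<lambda>t. t ^ Suc m * ?dF v (a + t *\<^sub>R (x - a)))"
  have contF: "continuous_on S F" and contdF: "\<And>v. continuous_on S (?dF v)"
    using Suc.prems Ck_on_imp_continuous_on[OF Suc.prems] by (auto intro: Ck_on_imp_continuous_on)
  note dF = Ck_on_Suc_imp_has_derivative[OF Suc.prems]
  have int: "(\<lambda>t. t ^ n * g (a + t *\<^sub>R (x - a))) integrable_on {0..1}"
    if "continuous_on S g" "x \<in> S" for x n and g :: "'e \<Rightarrow> real"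
    using that S by (intro integrable_continuous_real continuous_intros continuous_on_compose2[OF that(1)])
      (auto intro!: convex_segment_mem)
  show ?case
  proof (rule Ck_on_SucI[OF S(1)])
    show "Ck_on k (\<lambda>x. ?dI x v) S" for v
      using Suc.prems by (intro Suc.IH) simp
    fix x assume x: "x \<in> S"
    show "(?I has_derivative ?dI x) (at x)"
    \<comment> \<open>Along a line through \<open>y\<close> the parameter is real, so the
      one-variable Leibniz rule suffices; the total derivative then follows from linearity and
      continuity of the directional ones.\<close>
    proof (rule has_derivative_if_directional[OF B S(1) x])
      show "continuous_on S (\<lambda>y. ?dI y v)" for v
        by (rule continuous_on_radial_mean[OF S(2,3) contdF])
    next
      fix y assume y: "y \<in> S"
      have lin: "linear (frechet_derivative F (at (a + t *\<^sub>R (y - a))))" if "t \<in> {0..1}" for t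
        using that S y by (intro has_derivative_linear[OF dF] convex_segment_mem) auto
      show "linear (?dI y)"
      proof (rule linearI)
        show "?dI y (v + w) = ?dI y v + ?dI y w" for v w
          by (subst integral_add[symmetric, OF int[OF contdF y] int[OF contdF y]],
              rule integral_cong) (simp add: linear_add[OF lin] distrib_left)
        show "?dI y (c *\<^sub>R v) = c *\<^sub>R ?dI y v" for c v
          by (subst real_scaleR_def, subst integral_mult_right[symmetric], rule integral_cong)
            (simp add: linear_scale[OF lin])
      qed
    next
      fix y v assume y: "y \<in> S"
      have "open ((\<lambda>s. y + s *\<^sub>R v) -` S)"
        using S(1) by (intro open_vimage continuous_intros)
      moreover have "0 \<in> (\<lambda>s. y + s *\<^sub>R v) -` S" using y by simp
      ultimately obtain \<delta> :: real where \<delta>: "\<delta> > 0" "ball 0 \<delta> \<subseteq> (\<lambda>s. y + s *\<^sub>R v) -` S"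
        using open_contains_ball by blast
      \<comment> \<open>An interval, hence convex as the Leibniz rule requires. For each
        \<open>s\<close> in it, convexity of \<open>S\<close> keeps the whole segment from
        \<open>a\<close> to \<open>y + s *\<^sub>R v\<close> inside \<open>S\<close>.\<close>
      define U where "U = ball (0::real) \<delta>"
      have U: "y + s *\<^sub>R v \<in> S" if "s \<in> U" for s using \<delta>(2) that by (auto simp: U_def)
      let ?c = "\<lambda>s t. a + t *\<^sub>R (y + s *\<^sub>R v - a)"
      have c: "?c s t \<in> S" if "s \<in> U" "t \<in> {0..1}" for s t
        using that U S by (intro convex_segment_mem) auto
      have "((\<lambda>s. integral (cbox 0 1) (\<lambda>t. t ^ m * F (?c s t))) has_field_derivative
          integral (cbox 0 1) (\<lambda>t. t ^ Suc m * ?dF v (?c 0 t))) (at 0 within U)"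
      proof (rule leibniz_rule_field_derivative)
        fix s t assume st: "s \<in> U" "t \<in> cbox 0 (1::real)"
        have "((\<lambda>s. ?c s t) has_derivative (\<lambda>r. t *\<^sub>R (r *\<^sub>R v))) (at s)"
          by (auto intro!: derivative_eq_intros)
        from has_derivative_compose[OF this dF[OF c]]
        have "((\<lambda>s. F (?c s t)) has_derivative (\<lambda>r. ?dF (t *\<^sub>R (r *\<^sub>R v)) (?c s t))) (at s)"
          using st by simp
        moreover have "linear (frechet_derivative F (at (?c s t)))"
          using st by (intro has_derivative_linear[OF dF] c) auto
        then have "(\<lambda>r. ?dF (t *\<^sub>R (r *\<^sub>R v)) (?c s t)) = (*) (t * ?dF v (?c s t))"
          by (intro ext) (simp add: linear_scale mult_ac)
        ultimately have "((\<lambda>s. F (?c s t)) has_real_derivative t * ?dF v (?c s t)) (at s)"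
          by (simp add: has_field_derivative_def)
        from DERIV_cmult[OF this, of "t ^ m"]
        show "((\<lambda>s. t ^ m * F (?c s t)) has_field_derivative t ^ Suc m * ?dF v (?c s t)) (at s within U)"
          by (auto intro!: has_field_derivative_at_within simp: mult_ac)
      next
        show "(\<lambda>t. t ^ m * F (?c s t)) integrable_on cbox 0 1" if "s \<in> U" for s
          using int[OF contF U[OF that]] by simp
        show "continuous_on (U \<times> cbox 0 1) (\<lambda>(s, t). t ^ Suc m * ?dF v (?c s t))"
          unfolding case_prod_unfold
          by (intro continuous_intros continuous_on_compose2[OF contdF]) (auto intro!: c)
      qed (use \<delta>(1) in \<open>auto simp: U_def\<close>)
      then show "((\<lambda>t. ?I (y + t *\<^sub>R v)) has_real_derivative ?dI y v) (at 0)"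
        using \<delta>(1) at_within_open[of 0 U] by (simp add: U_def)
    qed
  qed
qed

text \<open>The fundamental theorem of calculus along the segment from \<open>a\<close> to
  \<open>x\<close>, with the direction \<open>x - a\<close> expanded in the frame:
  \<open>g b\<close> is the mean over that segment of the derivative of \<open>f\<close> in
  direction \<open>b\<close>.\<close>

lemma Hadamard_lemma:
  fixes f :: "'e::real_inner \<Rightarrow> real"
  assumes B: "parseval_frame (B :: 'e set)" and S: "open S" "convex S" "a \<in> S"
    and f: "smooth_on f S"
  obtains g where "\<And>b. smooth_on (g b) S" "\<And>b. g b a = frechet_derivative f (at a) b"
    and "\<And>x. x \<in> S \<Longrightarrow> f x = f a + (\<Sum>b\<in>B. ((x - a) \<bullet> b) * g b x)"
proof
  let ?df = "\<lambda>b x. frechet_derivative f (at x) b"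
  \<comment> \<open>The factor \<open>t ^ 0\<close> only brings the mean into the form of
    \<open>Ck_on_radial_mean\<close>.\<close>
  define g where "g b x = integral {0..1} (\<lambda>t. t ^ 0 * ?df b (a + t *\<^sub>R (x - a)))" for b x
  have Ck: "Ck_on (Suc k) f S" for k using f by (simp add: smooth_on_def del: Ck_on.simps)
  show "smooth_on (g b) S" for b
    unfolding smooth_on_def g_def
    using Ck by (intro allI Ck_on_radial_mean[OF B S]) simp
  show "g b a = ?df b a" for b by (simp add: g_def)
  note df = Ck_on_Suc_imp_has_derivative[OF Ck[of 0]]
  have cont: "continuous_on S (?df b)" for b using Ck[of 0] by simp
  fix x assume x: "x \<in> S"
  let ?c = "\<lambda>t. a + t *\<^sub>R (x - a)"
  have c: "?c t \<in> S" if "t \<in> {0..1}" for t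
    using that S x by (intro convex_segment_mem) auto
  have lin: "linear (frechet_derivative f (at (?c t)))" if "t \<in> {0..1}" for t
    using has_derivative_linear[OF df[OF c[OF that]]] .
  have int: "(\<lambda>t. ?df b (?c t)) integrable_on {0..1}" for b
    by (intro integrable_continuous_real continuous_intros continuous_on_compose2[OF cont])
      (auto intro!: c)
  have "((\<lambda>t. ?df (x - a) (?c t)) has_integral f (?c 1) - f (?c 0)) {0..1}"
  proof (rule fundamental_theorem_of_calculus)
    fix t :: real assume t: "t \<in> {0..1}"
    have "(?c has_derivative (\<lambda>r. r *\<^sub>R (x - a))) (at t)"
      by (auto intro!: derivative_eq_intros)
    from has_derivative_compose[OF this df[OF c[OF t]]]
    have "((\<lambda>t. f (?c t)) has_derivative (\<lambda>r. ?df (r *\<^sub>R (x - a)) (?c t))) (at t)" .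
    then show "((\<lambda>t. f (?c t)) has_vector_derivative ?df (x - a) (?c t)) (at t within {0..1})"
      by (auto simp: has_vector_derivative_def linear_scale[OF lin[OF t]]
          intro: has_derivative_at_withinI)
  qed simp
  then have "f x - f a = integral {0..1} (\<lambda>t. ?df (x - a) (?c t))"
    by (simp add: integral_unique)
  also have "\<dots> = integral {0..1} (\<lambda>t. \<Sum>b\<in>B. ((x - a) \<bullet> b) * ?df b (?c t))"
    by (rule integral_cong) (subst linear_parseval_frame[OF B lin], simp_all)
  also have "\<dots> = (\<Sum>b\<in>B. ((x - a) \<bullet> b) * g b x)"
    using B int by (subst integral_sum) (auto simp: parseval_frame_def g_def intro!: integrable_on_mult_right)
  finally show "f x = f a + (\<Sum>b\<in>B. ((x - a) \<bullet> b) * g b x)" by simp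
qed

section \<open>A flat function and smooth bumps\<close>

definition flat_exp :: "nat \<Rightarrow> real \<Rightarrow> real" where
  "flat_exp n s = (if s > 0 then inverse s ^ n * exp (- inverse s) else 0)"

lemma flat_exp_tendsto_0: "(flat_exp n \<longlongrightarrow> 0) (at 0)"
proof -
  have "((\<lambda>s. inverse s ^ n / exp (inverse s)) \<longlongrightarrow> (0::real)) (at_right 0)"
    by (rule filterlim_compose[OF tendsto_power_div_exp_0 filterlim_inverse_at_top_right])
  then have "(flat_exp n \<longlongrightarrow> 0) (at_right 0)"
    by (rule Lim_transform_eventually)
      (auto simp: flat_exp_def eventually_at_right_less exp_minus divide_inverse
        intro: eventually_mono[OF eventually_at_right_less])
  moreover have "(flat_exp n \<longlongrightarrow> 0) (at_left 0)"
    by (rule Lim_transform_eventually[of "\<lambda>_. 0"])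
      (auto simp: flat_exp_def eventually_at_filter)
  ultimately show ?thesis using filterlim_split_at by blast
qed

text \<open>The classical flat function is the case \<open>n = 0\<close>. The powers of
  \<open>1 / s\<close> are there so that the family is closed under differentiation up to linear
  combinations, and higher derivatives follow by an induction over all \<open>n\<close> at
  once.\<close>

lemma DERIV_flat_exp:
  "(flat_exp n has_real_derivative flat_exp (n + 2) s - real n * flat_exp (n + 1) s) (at s)"
proof -
  consider "s > 0" | "s < 0" | "s = 0" by linarith
  then show ?thesis
  proof cases
    case 1
    have "((\<lambda>s. inverse s ^ n) has_real_derivative - real n * inverse s ^ (n + 1)) (at s)"
    proof (cases n)
      case (Suc m)
      show ?thesis
        unfolding Suc using 1
        by (intro DERIV_cong[OF DERIV_power_Suc[OF DERIV_inverse]]) (simp_all add: algebra_simps power2_eq_square)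
    qed simp
    moreover have "((\<lambda>s. exp (- inverse s)) has_real_derivative exp (- inverse s) * inverse s ^ 2) (at s)"
      using 1 by (auto intro!: derivative_eq_intros simp: power2_eq_square)
    ultimately have "((\<lambda>s. inverse s ^ n * exp (- inverse s)) has_real_derivative
        flat_exp (n + 2) s - real n * flat_exp (n + 1) s) (at s)"
      by (rule DERIV_cong[OF DERIV_mult])
        (use 1 in \<open>simp add: flat_exp_def power2_eq_square algebra_simps\<close>)
    then show ?thesis
      using 1 has_field_derivative_transform_within_open[of _ _ s "{0<..}" "flat_exp n"]
      by (auto simp: flat_exp_def)
  next
    case 2
    have "((\<lambda>_. 0) has_real_derivative flat_exp (n + 2) s - real n * flat_exp (n + 1) s) (at s)"
      using 2 by (simp add: flat_exp_def)
    then show ?thesis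
      using 2 has_field_derivative_transform_within_open[of "\<lambda>_. 0" _ s "{..<0}" "flat_exp n"]
      by (auto simp: flat_exp_def)
  next
    case 3
    \<comment> \<open>Apart from \<open>h = 0\<close>, the difference quotient at the origin is
      \<open>flat_exp (Suc n) h\<close>.\<close>
    have "((\<lambda>h. (flat_exp n (0 + h) - flat_exp n 0) / h) \<longlongrightarrow> 0) (at 0)"
      by (rule Lim_transform_eventually[OF flat_exp_tendsto_0[of "Suc n"]])
        (auto simp: flat_exp_def eventually_at_filter field_simps)
    then have "(flat_exp n has_real_derivative 0) (at 0)" by (simp only: DERIV_def)
    then show ?thesis using 3 by (simp add: flat_exp_def)
  qed
qed

lemma Ck_on_flat_exp: "Ck_on k (flat_exp n) UNIV"
proof (induction k arbitrary: n)
  case 0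
  have "isCont (flat_exp n) s" for s using DERIV_flat_exp by (rule DERIV_isCont)
  then show ?case by (simp add: continuous_at_imp_continuous_on)
next
  case (Suc k)
  show ?case
  proof (rule Ck_on_SucI[OF open_UNIV])
    show "(flat_exp n has_derivative
        (\<lambda>v. (flat_exp (n + 2) s - real n * flat_exp (n + 1) s) * v)) (at s)" for s
      using DERIV_flat_exp by (simp add: has_field_derivative_def)
    show "Ck_on k (\<lambda>s. (flat_exp (n + 2) s - real n * flat_exp (n + 1) s) * v) UNIV" for v
      by (intro Ck_on_mult Ck_on_diff Ck_on_const Suc open_UNIV)
  qed
qed

text \<open>The quadratic function \<open>q\<close> is positive exactly on the ball, and the flat
  function is nonzero exactly on the positive reals.\<close>

lemma smooth_bump:
  fixes a :: "'e::real_inner"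
  assumes "r > 0"
  obtains \<beta> :: "'e \<Rightarrow> real" where "smooth_on \<beta> UNIV"
    and "\<And>x. x \<in> ball a r \<Longrightarrow> \<beta> x \<noteq> 0" "\<And>x. x \<notin> ball a r \<Longrightarrow> \<beta> x = 0"
proof
  define q where "q x = r\<^sup>2 - (x - a) \<bullet> (x - a)" for x
  have q: "q x > 0 \<longleftrightarrow> x \<in> ball a r" for x
  proof -
    have "q x > 0 \<longleftrightarrow> (norm (x - a))\<^sup>2 < r\<^sup>2" by (simp add: q_def power2_norm_eq_inner)
    also have "\<dots> \<longleftrightarrow> norm (x - a) < r"
      using assms by (auto intro: power_less_imp_less_base[of _ 2] power_strict_mono)
    finally show ?thesis by (simp add: dist_norm norm_minus_commute)
  qed
  have frame: "parseval_frame {1::real}" by (simp add: parseval_frame_def)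
  have "Ck_on k q UNIV" for k
  proof -
    \<comment> \<open>\<open>Ck_on_SucI\<close> reaches positive orders only; the order is raised by
      one and lowered again so that \<open>k = 0\<close> is included.\<close>
    have "Ck_on (Suc k) q UNIV"
    proof (rule Ck_on_SucI[OF open_UNIV])
      show "(q has_derivative (\<lambda>v. (- 2) * (x \<bullet> v - a \<bullet> v))) (at x)" for x
        unfolding q_def
        by (auto intro!: derivative_eq_intros simp: inner_commute algebra_simps)
      show "Ck_on k (\<lambda>x. (- 2) * (x \<bullet> v - a \<bullet> v)) UNIV" for v
        by (intro Ck_on_mult Ck_on_diff Ck_on_const open_UNIV Ck_on_linear bounded_linear_inner_left)
    qed
    then show ?thesis by (rule Ck_on_SucD)
  qed
  then show "smooth_on (\<lambda>x. flat_exp 0 (q x)) UNIV"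
    unfolding smooth_on_def
    by (intro allI Ck_on_compose[OF frame open_UNIV open_UNIV _ Ck_on_flat_exp]) auto
  show "flat_exp 0 (q x) \<noteq> 0" if "x \<in> ball a r" for x
    using that q by (simp add: flat_exp_def)
  show "flat_exp 0 (q x) = 0" if "x \<notin> ball a r" for x
    using that q by (simp add: flat_exp_def)
qed

section \<open>Smooth maps between manifolds\<close>

lemma smooth_on_cong:
  "open S \<Longrightarrow> (\<And>x. x \<in> S \<Longrightarrow> f x = g x) \<Longrightarrow> smooth_on f S \<longleftrightarrow> smooth_on g S"
  unfolding smooth_on_def using Ck_on_cong by blast

lemma smooth_on_eq:
  "smooth_on f S \<Longrightarrow> (\<And>x. x \<in> S \<Longrightarrow> f x = g x) \<Longrightarrow> open S \<Longrightarrow> smooth_on g S"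
  using smooth_on_cong by blast

lemma smooth_on_mono: "smooth_on f T \<Longrightarrow> S \<subseteq> T \<Longrightarrow> smooth_on f S"
  unfolding smooth_on_def using Ck_on_mono by blast

lemma smooth_on_local:
  "(\<And>x. x \<in> S \<Longrightarrow> \<exists>T. open T \<and> x \<in> T \<and> smooth_on f T) \<Longrightarrow> smooth_on f S"
  unfolding smooth_on_def
proof (rule allI, rule Ck_on_local)
  fix k x
  assume *: "\<And>x. x \<in> S \<Longrightarrow> \<exists>T. open T \<and> x \<in> T \<and> (\<forall>k. Ck_on k f T)" and "x \<in> S"
  then obtain T where "open T" "x \<in> T" "\<forall>k. Ck_on k f T" by blast
  then show "\<exists>T. open T \<and> x \<in> T \<and> Ck_on k f T" by (intro exI[of _ T]) simp
qed

lemma smooth_on_imp_continuous_on: "smooth_on f S \<Longrightarrow> continuous_on S f"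
  by (metis Ck_on.simps(1) smooth_on_def)

lemma smooth_on_const: "smooth_on (\<lambda>x. c) S"
  by (simp add: smooth_on_def Ck_on_const)

lemma smooth_on_linear: "bounded_linear L \<Longrightarrow> smooth_on L S"
  by (simp add: smooth_on_def Ck_on_linear)

lemma smooth_on_linear_comp:
  "bounded_linear L \<Longrightarrow> open S \<Longrightarrow> smooth_on f S \<Longrightarrow> smooth_on (\<lambda>x. L (f x)) S"
  by (simp add: smooth_on_def Ck_on_linear_comp)

lemma smooth_on_Pair:
  "open S \<Longrightarrow> smooth_on f S \<Longrightarrow> smooth_on g S \<Longrightarrow> smooth_on (\<lambda>x. (f x, g x)) S"
  by (simp add: smooth_on_def Ck_on_Pair)

lemma smooth_on_add:
  "open S \<Longrightarrow> smooth_on f S \<Longrightarrow> smooth_on g S \<Longrightarrow> smooth_on (\<lambda>x. f x + g x) S"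
  by (simp add: smooth_on_def Ck_on_add)

lemma smooth_on_diff:
  "open S \<Longrightarrow> smooth_on f S \<Longrightarrow> smooth_on g S \<Longrightarrow> smooth_on (\<lambda>x. f x - g x) S"
  by (simp add: smooth_on_def Ck_on_diff)

lemma smooth_on_sum:
  "open S \<Longrightarrow> (\<And>i. i \<in> I \<Longrightarrow> smooth_on (f i) S) \<Longrightarrow> smooth_on (\<lambda>x. \<Sum>i\<in>I. f i x) S"
  by (simp add: smooth_on_def Ck_on_sum)

lemma smooth_on_mult:
  fixes f g :: "'e::real_inner \<Rightarrow> real"
  shows "open S \<Longrightarrow> smooth_on f S \<Longrightarrow> smooth_on g S \<Longrightarrow> smooth_on (\<lambda>x. f x * g x) S"
  by (simp add: smooth_on_def Ck_on_mult)

lemma smooth_on_divide: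
  fixes f g :: "'e::real_inner \<Rightarrow> real"
  shows "open S \<Longrightarrow> smooth_on f S \<Longrightarrow> smooth_on g S \<Longrightarrow> (\<And>x. x \<in> S \<Longrightarrow> g x \<noteq> 0) \<Longrightarrow>
    smooth_on (\<lambda>x. f x / g x) S"
  by (simp add: smooth_on_def divide_inverse Ck_on_mult Ck_on_inverse)

lemma smooth_on_compose:
  assumes "parseval_frame (B :: 'f::real_inner set)" "open S" "open T" "g ` S \<subseteq> T"
    and "smooth_on f T" "smooth_on (g :: 'e::real_inner \<Rightarrow> 'f) S"
  shows "smooth_on (\<lambda>x. f (g x)) S"
  unfolding smooth_on_def
proof
  show "Ck_on k (\<lambda>x. f (g x)) S" for k
    using assms(5,6) unfolding smooth_on_def
    by - (rule Ck_on_compose[OF assms(1-4)], (erule spec)+)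
qed

lemma smooth_on_imp_has_derivative:
  assumes "smooth_on f S" "x \<in> S"
  shows "(f has_derivative frechet_derivative f (at x)) (at x)"
  using assms Ck_on_Suc_imp_has_derivative[of 0 f S x] by (simp add: smooth_on_def del: Ck_on.simps)

lemma smooth_on_frechet_derivative:
  assumes "smooth_on f S"
  shows "smooth_on (\<lambda>x. frechet_derivative f (at x) v) S"
  unfolding smooth_on_def
proof
  fix k
  have "Ck_on (Suc k) f S" using assms by (simp add: smooth_on_def del: Ck_on.simps)
  then show "Ck_on k (\<lambda>x. frechet_derivative f (at x) v) S" by simp
qed

text \<open>Heine-Borel in a space with a frame: the ball is a closed subset of a box of
  combinations of \<open>B\<close> with bounded coefficients. Compactness is what later makes the
  preimage of a ball under a chart closed in the manifold.\<close>

lemma parseval_frame_imp_compact_cball: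
  fixes a :: "'e::real_inner"
  assumes "parseval_frame (B :: 'e set)"
  shows "compact (cball a r)"
proof -
  \<comment> \<open>Boxes are compact by induction on \<open>C\<close>: each further vector adds an
    interval of coefficients, and the new box is a continuous image of the product of that interval
    with the old box.\<close>
  define box where "box C R = {\<Sum>b\<in>C. c b *\<^sub>R b | c. \<forall>b\<in>C. \<bar>c b\<bar> \<le> R}" for C :: "'e set" and R :: real
  have compact_box: "compact (box C R)" if "finite C" for C R
    using that
  proof (induction C)
    case empty
    have "box {} R = {0}" by (auto simp: box_def)
    then show ?case by simp
  next
    case (insert b C)
    have "box (insert b C) R = (\<lambda>(t, x). t *\<^sub>R b + x) ` ({- R..R} \<times> box C R)"
    proof (intro equalityI subsetI)
      fix x assume "x \<in> box (insert b C) R"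
      then show "x \<in> (\<lambda>(t, x). t *\<^sub>R b + x) ` ({- R..R} \<times> box C R)"
      proof -
        obtain c where c: "x = (\<Sum>d\<in>insert b C. c d *\<^sub>R d)" "\<forall>d\<in>insert b C. \<bar>c d\<bar> \<le> R"
          using \<open>x \<in> box (insert b C) R\<close> by (auto simp: box_def)
        have "x = (\<lambda>(t, x). t *\<^sub>R b + x) (c b, \<Sum>d\<in>C. c d *\<^sub>R d)" using c(1) insert by simp
        moreover have "(c b, \<Sum>d\<in>C. c d *\<^sub>R d) \<in> {- R..R} \<times> box C R"
          using c(2) by (auto simp: box_def abs_le_iff)
        ultimately show ?thesis by (rule image_eqI)
      qed
    next
      fix x assume "x \<in> (\<lambda>(t, x). t *\<^sub>R b + x) ` ({- R..R} \<times> box C R)"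
      then obtain t c where tc: "\<bar>t\<bar> \<le> R" "\<forall>b\<in>C. \<bar>c b\<bar> \<le> R" "x = t *\<^sub>R b + (\<Sum>b\<in>C. c b *\<^sub>R b)"
        by (force simp: box_def abs_le_iff)
      then have "x = (\<Sum>d\<in>insert b C. (c(b := t)) d *\<^sub>R d)"
        using insert by (auto intro!: sum.cong)
      moreover have "\<forall>d\<in>insert b C. \<bar>(c(b := t)) d\<bar> \<le> R" using tc insert by auto
      ultimately show "x \<in> box (insert b C) R" by (auto simp: box_def)
    qed
    moreover have "compact ((\<lambda>(t, x). t *\<^sub>R b + x) ` ({- R..R} \<times> box C R))"
      by (intro compact_continuous_image compact_Times insert compact_Icc)
        (auto simp: case_prod_unfold intro!: continuous_intros)
    ultimately show ?case by simp
  qed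
  have fin: "finite B" using assms by (simp add: parseval_frame_def)
  \<comment> \<open>Cauchy-Schwarz bounds the coefficient \<open>x \<bullet> b\<close> by the
    product of the norms, and the sum dominates each single \<open>norm b\<close>.\<close>
  define R where "R = (norm a + r) * (\<Sum>b\<in>B. norm b)"
  have "cball a r \<subseteq> box B R"
  proof
    fix x assume "x \<in> cball a r"
    then have x: "norm x \<le> norm a + r"
      using norm_triangle_sub[of x a] by (auto simp: dist_norm norm_minus_commute)
    have "\<bar>x \<bullet> b\<bar> \<le> R" if "b \<in> B" for b
    proof -
      have "\<bar>x \<bullet> b\<bar> \<le> norm x * norm b" by (rule Cauchy_Schwarz_ineq2)
      also have "\<dots> \<le> (norm a + r) * (\<Sum>b\<in>B. norm b)"
        using fin that x order_trans[OF norm_ge_zero x] by (intro mult_mono member_le_sum) auto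
      finally show ?thesis by (simp add: R_def)
    qed
    then show "x \<in> box B R"
      unfolding box_def using parseval_frame_expand[OF assms, of x, symmetric] by blast
  qed
  then have "cball a r = box B R \<inter> cball a r" by blast
  then show ?thesis
    using compact_Int_closed[OF compact_box[OF fin] closed_cball] by metis
qed

section \<open>Charts as homeomorphisms onto open sets\<close>

context smooth_manifold
begin

lemma frame_exists: obtains B :: "'e set" where "parseval_frame B"
  using finite_dim parseval_frame_exists by metis

lemma chart_at: obtains U \<phi> where "(U, \<phi>) \<in> A" "p \<in> U"
  using cover by (fastforce simp: set_eq_iff)

lemma chart_open: "(U, \<phi>) \<in> A \<Longrightarrow> open U"
  using charts by (force simp: is_chart_def)

lemma chart_homeomorphism: "(U, \<phi>) \<in> A \<Longrightarrow> homeomorphism U (\<phi> ` U) \<phi> (inv_into U \<phi>)"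
  using charts by (force simp: is_chart_def)

lemma chart_inv [simp]: "(U, \<phi>) \<in> A \<Longrightarrow> x \<in> U \<Longrightarrow> inv_into U \<phi> (\<phi> x) = x"
  using chart_homeomorphism by (simp add: homeomorphism_def)

lemma chart_inj_on: "(U, \<phi>) \<in> A \<Longrightarrow> inj_on \<phi> U"
  by (rule inj_on_inverseI) (rule chart_inv)

lemma chart_image_open: "(U, \<phi>) \<in> A \<Longrightarrow> open W \<Longrightarrow> W \<subseteq> U \<Longrightarrow> open (\<phi> ` W)"
proof -
  assume c: "(U, \<phi>) \<in> A" and W: "open W" "W \<subseteq> U"
  have "\<phi> ` W = \<phi> ` U \<inter> inv_into U \<phi> -` W"
    using W(2) c by force
  moreover have "open (inv_into U \<phi> -` W \<inter> \<phi> ` U)"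
    using chart_homeomorphism[OF c] charts[OF c] W(1)
    by (simp add: homeomorphism_def is_chart_def continuous_on_open_vimage)
  ultimately show ?thesis by (simp add: Int_commute)
qed

lemma continuous_on_chart: "(U, \<phi>) \<in> A \<Longrightarrow> W \<subseteq> U \<Longrightarrow> continuous_on W \<phi>"
  using chart_homeomorphism by (auto simp: homeomorphism_def intro: continuous_on_subset)

lemma continuous_on_inv_chart: "(U, \<phi>) \<in> A \<Longrightarrow> T \<subseteq> \<phi> ` U \<Longrightarrow> continuous_on T (inv_into U \<phi>)"
  using chart_homeomorphism by (auto simp: homeomorphism_def intro: continuous_on_subset)

end

text \<open>Transition maps are smooth, so one pair of charts around each point decides smoothness
  in every pair. Continuity, which \<open>smooth_map\<close> asks for separately, is recovered from
  the local expression because charts are homeomorphisms.\<close>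

lemma smooth_map_if_local:
  assumes A: "smooth_manifold (A :: ('a::{t2_space,second_countable_topology}, 'e::real_inner) atlas)"
    and B: "smooth_manifold (B :: ('b::{t2_space,second_countable_topology}, 'f::real_inner) atlas)"
    and loc: "\<And>p. \<exists>U \<phi> V \<psi> W. (U, \<phi>) \<in> A \<and> (V, \<psi>) \<in> B \<and> open W \<and> p \<in> W \<and> W \<subseteq> U \<and> f ` W \<subseteq> V \<and>
      smooth_on (\<lambda>x. \<psi> (f (inv_into U \<phi> x))) (\<phi> ` W)"
  shows "smooth_map A B f"
proof -
  interpret A: smooth_manifold A by fact
  interpret B: smooth_manifold B by fact
  obtain BA :: "'e set" where BA: "parseval_frame BA" by (rule A.frame_exists)
  obtain BB :: "'f set" where BB: "parseval_frame BB" by (rule B.frame_exists)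
  have "isCont f p" for p
  proof -
    obtain U \<phi> V \<psi> W where UV: "(U, \<phi>) \<in> A" "(V, \<psi>) \<in> B"
      and W: "open W" "p \<in> W" "W \<subseteq> U" "f ` W \<subseteq> V"
      and sm: "smooth_on (\<lambda>x. \<psi> (f (inv_into U \<phi> x))) (\<phi> ` W)"
      using loc[of p] by blast
    have "continuous_on W (\<lambda>x. \<psi> (f (inv_into U \<phi> (\<phi> x))))"
      using continuous_on_compose2[OF smooth_on_imp_continuous_on[OF sm] A.continuous_on_chart[OF UV(1) W(3)]]
      by auto
    moreover have inv: "inv_into U \<phi> (\<phi> x) = x" if "x \<in> W" for x
      using that W UV by auto
    ultimately have "continuous_on W (\<lambda>x. \<psi> (f x))" by (simp cong: continuous_on_cong)
    then have "continuous_on W (\<lambda>x. inv_into V \<psi> (\<psi> (f x)))"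
      by (rule continuous_on_compose2[OF B.continuous_on_inv_chart[OF UV(2) order_refl]])
        (use W in auto)
    moreover have "inv_into V \<psi> (\<psi> (f x)) = f x" if "x \<in> W" for x
      using that W UV by auto
    ultimately have "continuous_on W f" by (simp cong: continuous_on_cong)
    then show ?thesis using W by (simp add: continuous_on_eq_continuous_at)
  qed
  then have cont: "continuous_on UNIV f" by (simp add: continuous_at_imp_continuous_on)
  moreover have "smooth_on (\<psi>' \<circ> f \<circ> inv_into U' \<phi>') (\<phi>' ` (U' \<inter> f -` V'))"
    if c': "(U', \<phi>') \<in> A" "(V', \<psi>') \<in> B" for U' \<phi>' V' \<psi>'
  proof (rule smooth_on_local)
    fix x assume "x \<in> \<phi>' ` (U' \<inter> f -` V')"
    then obtain p where p: "p \<in> U'" "f p \<in> V'" "x = \<phi>' p" by auto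
    obtain U \<phi> V \<psi> W where UV: "(U, \<phi>) \<in> A" "(V, \<psi>) \<in> B"
      and W: "open W" "p \<in> W" "W \<subseteq> U" "f ` W \<subseteq> V"
      and sm: "smooth_on (\<lambda>x. \<psi> (f (inv_into U \<phi> x))) (\<phi> ` W)"
      using loc[of p] by blast
    define N where "N = U' \<inter> W \<inter> f -` V'"
    have "open (f -` V')"
      using cont B.chart_open[OF c'(2)] by (simp add: continuous_on_open_vimage)
    then have N: "open N" "p \<in> N" "N \<subseteq> U'" "N \<subseteq> U" "N \<subseteq> W"
      using A.chart_open[OF c'(1)] W p by (auto simp: N_def)
    have fN: "f y \<in> V \<inter> V'" if "y \<in> N" for y using that W by (auto simp: N_def)
    \<comment> \<open>In the given charts \<open>f\<close> factors as a transition map of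
      \<open>A\<close>, the local expression known to be smooth, and a transition map of
      \<open>B\<close>; \<open>N\<close> is small enough for the three to compose.\<close>
    let ?g = "\<lambda>x. \<phi> (inv_into U' \<phi>' x)"
    let ?h = "\<lambda>x. \<psi> (f (inv_into U \<phi> x))"
    let ?k = "\<lambda>x. \<psi>' (inv_into V \<psi> x)"
    have g: "smooth_on ?g (\<phi>' ` N)"
      using smooth_on_mono[OF A.compatible[OF c'(1) UV(1)], of "\<phi>' ` N"] N by (auto simp: o_def)
    have k: "smooth_on ?k (\<psi> ` (V \<inter> V'))"
      using B.compatible[OF UV(2) c'(2)] by (simp add: o_def)
    have op: "open (\<phi>' ` N)" "open (\<phi> ` N)" "open (\<psi> ` (V \<inter> V'))"
      using N A.chart_image_open[OF c'(1)] A.chart_image_open[OF UV(1)]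
        B.chart_image_open[OF UV(2) open_Int[OF B.chart_open[OF UV(2)] B.chart_open[OF c'(2)]]] by auto
    have "smooth_on (\<lambda>x. ?h (?g x)) (\<phi>' ` N)"
      by (rule smooth_on_compose[OF BA op(1,2) _ smooth_on_mono[OF sm] g]) (use N c' in auto)
    then have "smooth_on (\<lambda>x. ?k (?h (?g x))) (\<phi>' ` N)"
      using N c' UV fN by (intro smooth_on_compose[OF BB op(1,3) _ k]) (auto simp: subset_iff)
    moreover have "?k (?h (?g x)) = (\<psi>' \<circ> f \<circ> inv_into U' \<phi>') x" if "x \<in> \<phi>' ` N" for x
      using that N c' UV fN by (auto simp: subset_iff)
    ultimately have "smooth_on (\<psi>' \<circ> f \<circ> inv_into U' \<phi>') (\<phi>' ` N)"
      using op(1) by (rule smooth_on_eq)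
    then show "\<exists>T. open T \<and> x \<in> T \<and> smooth_on (\<psi>' \<circ> f \<circ> inv_into U' \<phi>') T"
      using op N p by blast
  qed
  ultimately show ?thesis by (auto simp: smooth_map_def)
qed

lemma smooth_mapD:
  assumes "smooth_map A B f" "(U, \<phi>) \<in> A" "(V, \<psi>) \<in> B"
  shows "smooth_on (\<lambda>x. \<psi> (f (inv_into U \<phi> x))) (\<phi> ` (U \<inter> f -` V))"
  using assms by (force simp: smooth_map_def o_def)

lemma smooth_map_open_vimage: "smooth_map A B f \<Longrightarrow> open V \<Longrightarrow> open (f -` V)"
  by (simp add: smooth_map_def continuous_on_open_vimage)

lemma smooth_map_compose:
  assumes A: "smooth_manifold (A :: ('a::{t2_space,second_countable_topology}, 'e::real_inner) atlas)"
    and B: "smooth_manifold (B :: ('b::{t2_space,second_countable_topology}, 'f::real_inner) atlas)"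
    and C: "smooth_manifold (C :: ('c::{t2_space,second_countable_topology}, 'g::real_inner) atlas)"
    and f: "smooth_map A B f" and g: "smooth_map B C g"
  shows "smooth_map A C (\<lambda>x. g (f x))"
proof (rule smooth_map_if_local[OF A C])
  interpret A: smooth_manifold A by fact
  interpret B: smooth_manifold B by fact
  interpret C: smooth_manifold C by fact
  obtain F :: "'f set" where F: "parseval_frame F" by (rule B.frame_exists)
  fix p
  obtain U \<phi> where U: "(U, \<phi>) \<in> A" "p \<in> U" by (rule A.chart_at)
  obtain V \<psi> where V: "(V, \<psi>) \<in> B" "f p \<in> V" by (rule B.chart_at)
  obtain Z \<zeta> where Z: "(Z, \<zeta>) \<in> C" "g (f p) \<in> Z" by (rule C.chart_at)
  define V' where "V' = V \<inter> g -` Z"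
  define W where "W = U \<inter> f -` V'"
  have V': "open V'" "V' \<subseteq> V" "f p \<in> V'"
    using B.chart_open[OF V(1)] smooth_map_open_vimage[OF g C.chart_open[OF Z(1)]] V Z
    by (auto simp: V'_def)
  have W: "open W" "W \<subseteq> U" "p \<in> W" "f ` W \<subseteq> V'"
    using A.chart_open[OF U(1)] smooth_map_open_vimage[OF f V'(1)] U V' by (auto simp: W_def)
  have f': "smooth_on (\<lambda>x. \<psi> (f (inv_into U \<phi> x))) (\<phi> ` W)"
    using smooth_mapD[OF f U(1) V(1)] by (rule smooth_on_mono) (use V' in \<open>auto simp: W_def\<close>)
  have g': "smooth_on (\<lambda>x. \<zeta> (g (inv_into V \<psi> x))) (\<psi> ` V')"
    using smooth_mapD[OF g V(1) Z(1)] by (simp add: V'_def)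
  have op: "open (\<phi> ` W)" "open (\<psi> ` V')"
    using W V' A.chart_image_open[OF U(1)] B.chart_image_open[OF V(1)] by auto
  have "smooth_on (\<lambda>x. \<zeta> (g (inv_into V \<psi> (\<psi> (f (inv_into U \<phi> x)))))) (\<phi> ` W)"
    by (rule smooth_on_compose[OF F op _ g' f']) (use U W in \<open>auto simp: subset_iff\<close>)
  moreover have "\<zeta> (g (inv_into V \<psi> (\<psi> (f (inv_into U \<phi> x))))) = \<zeta> (g (f (inv_into U \<phi> x)))"
    if "x \<in> \<phi> ` W" for x
    using that U V W V' by (auto simp: subset_iff)
  ultimately have "smooth_on (\<lambda>x. \<zeta> (g (f (inv_into U \<phi> x)))) (\<phi> ` W)"
    using op(1) by (rule smooth_on_eq)
  moreover have "(\<lambda>x. g (f x)) ` W \<subseteq> Z" using W(4) by (auto simp: V'_def)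
  ultimately show "\<exists>U \<phi> V \<psi> W. (U, \<phi>) \<in> A \<and> (V, \<psi>) \<in> C \<and> open W \<and> p \<in> W \<and> W \<subseteq> U \<and>
      (\<lambda>x. g (f x)) ` W \<subseteq> V \<and> smooth_on (\<lambda>x. \<psi> (g (f (inv_into U \<phi> x)))) (\<phi> ` W)"
    using U(1) Z(1) W by blast
qed

section \<open>The real line and products as manifolds\<close>

lemma inv_ident: "inv_into UNIV (\<lambda>x. x) = (\<lambda>x. x)"
  using inv_id by (simp add: id_def)

lemma smooth_manifold_real_atlas: "smooth_manifold real_atlas"
proof
  show "\<exists>B::real set. finite B \<and> span B = UNIV"
  proof (intro exI conjI)
    have "x \<in> span {1::real}" for x
      using span_scale[OF span_base[of "1::real" "{1}"], of x] by simp
    then show "span {1::real} = UNIV" by blast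
  qed simp
  show "is_chart c" if "c \<in> real_atlas" for c :: "real set \<times> (real \<Rightarrow> real)"
    using that by (auto simp: real_atlas_def is_chart_def homeomorphism_def inv_ident)
  show "(\<Union>(U, \<phi>)\<in>real_atlas. U) = (UNIV :: real set)" by (auto simp: real_atlas_def)
  show "smooth_on (\<psi> \<circ> inv_into U \<phi>) (\<phi> ` (U \<inter> V))"
    if "(U, \<phi>) \<in> real_atlas" "(V, \<psi>) \<in> real_atlas" for U V :: "real set" and \<phi> \<psi>
    using that smooth_on_linear[OF bounded_linear_ident]
    by (auto simp: real_atlas_def inv_ident o_def)
qed

lemma inv_into_map_prod:
  assumes "inj_on f U" "inj_on g V" "x \<in> f ` U" "y \<in> g ` V"
  shows "inv_into (U \<times> V) (map_prod f g) (x, y) = (inv_into U f x, inv_into V g y)"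
  using assms by (intro inv_into_f_eq) (auto simp: inj_on_def inv_into_into f_inv_into_f)

lemma smooth_manifold_prod_atlas:
  assumes A: "smooth_manifold (A :: ('a::{t2_space,second_countable_topology}, 'e::real_inner) atlas)"
    and B: "smooth_manifold (B :: ('b::{t2_space,second_countable_topology}, 'f::real_inner) atlas)"
  shows "smooth_manifold (prod_atlas A B)"
proof
  interpret A: smooth_manifold A by fact
  interpret B: smooth_manifold B by fact
  obtain BA :: "'e set" where BA: "parseval_frame BA" by (rule A.frame_exists)
  obtain BB :: "'f set" where BB: "parseval_frame BB" by (rule B.frame_exists)
  obtain F :: "('e \<times> 'f) set" where F: "parseval_frame F"
    using parseval_frame_Times[OF BA BB] by blast
  then have "finite F" "x \<in> span F" for x
    using parseval_frame_expand[OF F, of x, symmetric] span_sum[of F "\<lambda>b. (x \<bullet> b) *\<^sub>R b" F]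
    by (auto simp: parseval_frame_def span_base span_scale)
  then show "\<exists>B::('e \<times> 'f) set. finite B \<and> span B = UNIV" by blast
  have inj: "(U, \<phi>) \<in> A \<Longrightarrow> inj_on \<phi> U" "(V, \<psi>) \<in> B \<Longrightarrow> inj_on \<psi> V" for U \<phi> V \<psi>
    by (simp_all add: A.chart_inj_on B.chart_inj_on)
  show "is_chart c" if c: "c \<in> prod_atlas A B" for c
  proof -
    obtain U \<phi> V \<psi> where UV: "(U, \<phi>) \<in> A" "(V, \<psi>) \<in> B" "c = (U \<times> V, map_prod \<phi> \<psi>)"
      using c by (auto simp: prod_atlas_def)
    have im: "map_prod \<phi> \<psi> ` (U \<times> V) = \<phi> ` U \<times> \<psi> ` V" by (rule map_prod_image)
    have inv: "inv_into (U \<times> V) (map_prod \<phi> \<psi>) z = (inv_into U \<phi> (fst z), inv_into V \<psi> (snd z))"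
      if "z \<in> \<phi> ` U \<times> \<psi> ` V" for z
      using that inv_into_map_prod[OF inj(1)[OF UV(1)] inj(2)[OF UV(2)]] by auto
    have "continuous_on (U \<times> V) (map_prod \<phi> \<psi>)"
      unfolding map_prod_def case_prod_unfold
      by (intro continuous_on_Pair continuous_on_compose2[OF A.continuous_on_chart[OF UV(1) order_refl]]
          continuous_on_compose2[OF B.continuous_on_chart[OF UV(2) order_refl]]) (auto intro!: continuous_intros)
    moreover have "continuous_on (\<phi> ` U \<times> \<psi> ` V) (inv_into (U \<times> V) (map_prod \<phi> \<psi>))"
    proof -
      have "continuous_on (\<phi> ` U \<times> \<psi> ` V) (\<lambda>z. (inv_into U \<phi> (fst z), inv_into V \<psi> (snd z)))"
        by (intro continuous_on_Pair
            continuous_on_compose2[OF A.continuous_on_inv_chart[OF UV(1) order_refl]]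
            continuous_on_compose2[OF B.continuous_on_inv_chart[OF UV(2) order_refl]])
          (auto intro!: continuous_intros)
      then show ?thesis by (simp add: inv cong: continuous_on_cong)
    qed
    ultimately have "homeomorphism (U \<times> V) (\<phi> ` U \<times> \<psi> ` V) (map_prod \<phi> \<psi>)
        (inv_into (U \<times> V) (map_prod \<phi> \<psi>))"
      using UV by (intro homeomorphismI) (auto simp: inv)
    then show ?thesis
      using UV A.chart_open B.chart_open A.chart_image_open[OF UV(1)] B.chart_image_open[OF UV(2)]
      by (auto simp: is_chart_def im open_Times)
  qed
  show "(\<Union>(U, \<phi>)\<in>prod_atlas A B. U) = (UNIV :: ('a \<times> 'b) set)"
  proof -
    have "\<exists>c\<in>prod_atlas A B. (p, q) \<in> fst c" for p q
    proof -
      obtain U \<phi> where U: "(U, \<phi>) \<in> A" "p \<in> U" by (rule A.chart_at)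
      obtain V \<psi> where V: "(V, \<psi>) \<in> B" "q \<in> V" by (rule B.chart_at)
      from U V have "(U \<times> V, map_prod \<phi> \<psi>) \<in> prod_atlas A B" "(p, q) \<in> U \<times> V"
        by (auto simp: prod_atlas_def)
      then show ?thesis by force
    qed
    then show ?thesis by (auto simp: case_prod_unfold)
  qed
  show "smooth_on (\<psi> \<circ> inv_into U \<phi>) (\<phi> ` (U \<inter> V))"
    if UV: "(U, \<phi>) \<in> prod_atlas A B" "(V, \<psi>) \<in> prod_atlas A B"
    for U V and \<phi> \<psi> :: "'a \<times> 'b \<Rightarrow> 'e \<times> 'f"
  proof -
    obtain U1 \<phi>1 U2 \<phi>2 where U: "(U1, \<phi>1) \<in> A" "(U2, \<phi>2) \<in> B" "U = U1 \<times> U2" "\<phi> = map_prod \<phi>1 \<phi>2"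
      using UV(1) by (auto simp: prod_atlas_def)
    obtain V1 \<psi>1 V2 \<psi>2 where V: "(V1, \<psi>1) \<in> A" "(V2, \<psi>2) \<in> B" "V = V1 \<times> V2" "\<psi> = map_prod \<psi>1 \<psi>2"
      using UV(2) by (auto simp: prod_atlas_def)
    define S1 where "S1 = \<phi>1 ` (U1 \<inter> V1)"
    define S2 where "S2 = \<phi>2 ` (U2 \<inter> V2)"
    have im: "\<phi> ` (U \<inter> V) = S1 \<times> S2"
      by (simp add: U V S1_def S2_def Times_Int_Times map_prod_image)
    have op: "open S1" "open S2"
      using A.chart_image_open[OF U(1) open_Int[OF A.chart_open[OF U(1)] A.chart_open[OF V(1)]]]
        B.chart_image_open[OF U(2) open_Int[OF B.chart_open[OF U(2)] B.chart_open[OF V(2)]]]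
      by (auto simp: S1_def S2_def)
    have "smooth_on (\<lambda>z. ((\<psi>1 \<circ> inv_into U1 \<phi>1) (fst z), (\<psi>2 \<circ> inv_into U2 \<phi>2) (snd z))) (S1 \<times> S2)"
    proof (rule smooth_on_Pair[OF open_Times[OF op]])
      show "smooth_on (\<lambda>z. (\<psi>1 \<circ> inv_into U1 \<phi>1) (fst z)) (S1 \<times> S2)"
        by (rule smooth_on_compose[OF BA open_Times[OF op] op(1) _
              A.compatible[OF U(1) V(1), folded S1_def] smooth_on_linear[OF bounded_linear_fst]]) auto
      show "smooth_on (\<lambda>z. (\<psi>2 \<circ> inv_into U2 \<phi>2) (snd z)) (S1 \<times> S2)"
        by (rule smooth_on_compose[OF BB open_Times[OF op] op(2) _
              B.compatible[OF U(2) V(2), folded S2_def] smooth_on_linear[OF bounded_linear_snd]]) auto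
    qed
    moreover have "((\<psi>1 \<circ> inv_into U1 \<phi>1) (fst z), (\<psi>2 \<circ> inv_into U2 \<phi>2) (snd z)) = (\<psi> \<circ> inv_into U \<phi>) z"
      if "z \<in> S1 \<times> S2" for z
      using that inv_into_map_prod[OF inj(1)[OF U(1)] inj(2)[OF U(2)], of "fst z" "snd z"]
      by (auto simp: U V S1_def S2_def)
    ultimately show ?thesis
      unfolding im using open_Times[OF op] by (rule smooth_on_eq)
  qed
qed

section \<open>Tangent vectors in coordinates\<close>

lemma prod_atlasI:
  "(U, \<phi>) \<in> A \<Longrightarrow> (V, \<psi>) \<in> B \<Longrightarrow> (U \<times> V, map_prod \<phi> \<psi>) \<in> prod_atlas A B"
  by (auto simp: prod_atlas_def)

lemma inv_into_prod_chart:
  assumes "smooth_manifold A" "smooth_manifold B" "(U, \<phi>) \<in> A" "(V, \<psi>) \<in> B"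
    and "z \<in> \<phi> ` U \<times> \<psi> ` V"
  shows "inv_into (U \<times> V) (map_prod \<phi> \<psi>) z = (inv_into U \<phi> (fst z), inv_into V \<psi> (snd z))"
proof -
  have "inj_on \<phi> U" "inj_on \<psi> V"
    using assms by (blast intro: smooth_manifold.chart_inj_on)+
  then show ?thesis
    using inv_into_map_prod[of \<phi> U \<psi> V "fst z" "snd z"] assms(5) by auto
qed

lemma smooth_map_Pair:
  assumes A: "smooth_manifold (A :: ('a::{t2_space,second_countable_topology}, 'e::real_inner) atlas)"
    and B: "smooth_manifold (B :: ('b::{t2_space,second_countable_topology}, 'f::real_inner) atlas)"
    and C: "smooth_manifold (C :: ('c::{t2_space,second_countable_topology}, 'g::real_inner) atlas)"
    and f: "smooth_map A B f" and g: "smooth_map A C g"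
  shows "smooth_map A (prod_atlas B C) (\<lambda>x. (f x, g x))"
proof (rule smooth_map_if_local[OF A smooth_manifold_prod_atlas[OF B C]])
  interpret A: smooth_manifold A by fact
  interpret B: smooth_manifold B by fact
  interpret C: smooth_manifold C by fact
  fix p
  obtain U \<phi> where U: "(U, \<phi>) \<in> A" "p \<in> U" by (rule A.chart_at)
  obtain V \<psi> where V: "(V, \<psi>) \<in> B" "f p \<in> V" by (rule B.chart_at)
  obtain Z \<zeta> where Z: "(Z, \<zeta>) \<in> C" "g p \<in> Z" by (rule C.chart_at)
  define W where "W = U \<inter> f -` V \<inter> g -` Z"
  have W: "open W" "p \<in> W" "W \<subseteq> U" "W \<subseteq> f -` V" "W \<subseteq> g -` Z"
    using A.chart_open[OF U(1)] smooth_map_open_vimage[OF f B.chart_open[OF V(1)]]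
      smooth_map_open_vimage[OF g C.chart_open[OF Z(1)]] U V Z by (auto simp: W_def)
  have "smooth_on (\<lambda>x. (\<psi> (f (inv_into U \<phi> x)), \<zeta> (g (inv_into U \<phi> x)))) (\<phi> ` W)"
  proof (rule smooth_on_Pair)
    show "open (\<phi> ` W)" using A.chart_image_open U W by blast
    show "smooth_on (\<lambda>x. \<psi> (f (inv_into U \<phi> x))) (\<phi> ` W)"
      using smooth_mapD[OF f U(1) V(1)] by (rule smooth_on_mono) (auto simp: W_def)
    show "smooth_on (\<lambda>x. \<zeta> (g (inv_into U \<phi> x))) (\<phi> ` W)"
      using smooth_mapD[OF g U(1) Z(1)] by (rule smooth_on_mono) (auto simp: W_def)
  qed
  then have "smooth_on (\<lambda>x. map_prod \<psi> \<zeta> (f (inv_into U \<phi> x), g (inv_into U \<phi> x))) (\<phi> ` W)"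
    by simp
  moreover have "(\<lambda>x. (f x, g x)) ` W \<subseteq> V \<times> Z" using W by auto
  ultimately show "\<exists>U \<phi> V \<psi> W. (U, \<phi>) \<in> A \<and> (V, \<psi>) \<in> prod_atlas B C \<and> open W \<and> p \<in> W \<and> W \<subseteq> U \<and>
      (\<lambda>x. (f x, g x)) ` W \<subseteq> V \<and>
      smooth_on (\<lambda>x. \<psi> (f (inv_into U \<phi> x), g (inv_into U \<phi> x))) (\<phi> ` W)"
    using U(1) prod_atlasI[OF V(1) Z(1)] W by blast
qed

lemma smooth_map_fst:
  assumes A: "smooth_manifold (A :: ('a::{t2_space,second_countable_topology}, 'e::real_inner) atlas)"
    and B: "smooth_manifold (B :: ('b::{t2_space,second_countable_topology}, 'f::real_inner) atlas)"
  shows "smooth_map (prod_atlas A B) A fst"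
proof (rule smooth_map_if_local[OF smooth_manifold_prod_atlas[OF A B] A])
  interpret A: smooth_manifold A by fact
  interpret B: smooth_manifold B by fact
  fix p :: "'a \<times> 'b"
  obtain U \<phi> where U: "(U, \<phi>) \<in> A" "fst p \<in> U" by (rule A.chart_at)
  obtain V \<psi> where V: "(V, \<psi>) \<in> B" "snd p \<in> V" by (rule B.chart_at)
  have op: "open (\<phi> ` U \<times> \<psi> ` V)" "open (U \<times> V)"
    using U V A.chart_open B.chart_open A.chart_image_open B.chart_image_open
    by (auto intro!: open_Times)
  have "smooth_on (\<lambda>z. \<phi> (fst (inv_into (U \<times> V) (map_prod \<phi> \<psi>) z))) (\<phi> ` U \<times> \<psi> ` V)"
    using smooth_on_linear[OF bounded_linear_fst] _ op(1)
    by (rule smooth_on_eq) (use U V inv_into_prod_chart[OF A B U(1) V(1)] in auto)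
  then have "smooth_on (\<lambda>z. \<phi> (fst (inv_into (U \<times> V) (map_prod \<phi> \<psi>) z))) (map_prod \<phi> \<psi> ` (U \<times> V))"
    by (simp add: map_prod_image)
  moreover have "p \<in> U \<times> V" "fst ` (U \<times> V) \<subseteq> U" using U V by (auto simp: mem_Times_iff)
  ultimately show "\<exists>U \<phi> V \<psi> W. (U, \<phi>) \<in> prod_atlas A B \<and> (V, \<psi>) \<in> A \<and> open W \<and> p \<in> W \<and>
      W \<subseteq> U \<and> fst ` W \<subseteq> V \<and> smooth_on (\<lambda>x. \<psi> (fst (inv_into U \<phi> x))) (\<phi> ` W)"
    using U(1) prod_atlasI[OF U(1) V(1)] op by blast
qed

lemma smooth_map_snd:
  assumes A: "smooth_manifold (A :: ('a::{t2_space,second_countable_topology}, 'e::real_inner) atlas)"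
    and B: "smooth_manifold (B :: ('b::{t2_space,second_countable_topology}, 'f::real_inner) atlas)"
  shows "smooth_map (prod_atlas A B) B snd"
proof (rule smooth_map_if_local[OF smooth_manifold_prod_atlas[OF A B] B])
  interpret A: smooth_manifold A by fact
  interpret B: smooth_manifold B by fact
  fix p :: "'a \<times> 'b"
  obtain U \<phi> where U: "(U, \<phi>) \<in> A" "fst p \<in> U" by (rule A.chart_at)
  obtain V \<psi> where V: "(V, \<psi>) \<in> B" "snd p \<in> V" by (rule B.chart_at)
  have op: "open (\<phi> ` U \<times> \<psi> ` V)" "open (U \<times> V)"
    using U V A.chart_open B.chart_open A.chart_image_open B.chart_image_open
    by (auto intro!: open_Times)
  have "smooth_on (\<lambda>z. \<psi> (snd (inv_into (U \<times> V) (map_prod \<phi> \<psi>) z))) (\<phi> ` U \<times> \<psi> ` V)"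
    using smooth_on_linear[OF bounded_linear_snd] _ op(1)
    by (rule smooth_on_eq) (use U V inv_into_prod_chart[OF A B U(1) V(1)] in auto)
  then have "smooth_on (\<lambda>z. \<psi> (snd (inv_into (U \<times> V) (map_prod \<phi> \<psi>) z))) (map_prod \<phi> \<psi> ` (U \<times> V))"
    by (simp add: map_prod_image)
  moreover have "p \<in> U \<times> V" "snd ` (U \<times> V) \<subseteq> V" using U V by (auto simp: mem_Times_iff)
  ultimately show "\<exists>U \<phi> V \<psi> W. (U, \<phi>) \<in> prod_atlas A B \<and> (V, \<psi>) \<in> B \<and> open W \<and> p \<in> W \<and>
      W \<subseteq> U \<and> snd ` W \<subseteq> V \<and> smooth_on (\<lambda>x. \<psi> (snd (inv_into U \<phi> x))) (\<phi> ` W)"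
    using V(1) prod_atlasI[OF U(1) V(1)] op by blast
qed

lemma smooth_map_const:
  assumes A: "smooth_manifold (A :: ('a::{t2_space,second_countable_topology}, 'e::real_inner) atlas)"
    and B: "smooth_manifold (B :: ('b::{t2_space,second_countable_topology}, 'f::real_inner) atlas)"
  shows "smooth_map A B (\<lambda>_. c)"
proof (rule smooth_map_if_local[OF A B])
  fix p
  obtain U \<phi> where U: "(U, \<phi>) \<in> A" "p \<in> U" by (rule smooth_manifold.chart_at[OF A])
  obtain V \<psi> where V: "(V, \<psi>) \<in> B" "c \<in> V" by (rule smooth_manifold.chart_at[OF B])
  show "\<exists>U \<phi> V \<psi> W. (U, \<phi>) \<in> A \<and> (V, \<psi>) \<in> B \<and> open W \<and> p \<in> W \<and> W \<subseteq> U \<and> (\<lambda>_. c) ` W \<subseteq> V \<and>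
      smooth_on (\<lambda>x. \<psi> c) (\<phi> ` W)"
    using U V smooth_on_const smooth_manifold.chart_open[OF A U(1)]
    by (intro exI[of _ U] exI[of _ \<phi>] exI[of _ V] exI[of _ \<psi>]) auto
qed

lemma smooth_map_ident: "smooth_manifold A \<Longrightarrow> smooth_map A A (\<lambda>x. x)"
  unfolding smooth_map_def using smooth_manifold.compatible by (fastforce simp: o_def)

section \<open>The algebra of smooth functions\<close>

context smooth_manifold
begin

lemma smooth_funD:
  "f \<in> smooth_fun A \<Longrightarrow> (U, \<phi>) \<in> A \<Longrightarrow> smooth_on (\<lambda>x. f (inv_into U \<phi> x)) (\<phi> ` U)"
  using smooth_mapD[of A real_atlas f U \<phi> UNIV "\<lambda>x. x"] by (simp add: smooth_fun_def real_atlas_def)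

lemma smooth_fun_if_local:
  assumes "\<And>p. \<exists>U \<phi> W. (U, \<phi>) \<in> A \<and> open W \<and> p \<in> W \<and> W \<subseteq> U \<and>
    smooth_on (\<lambda>x. f (inv_into U \<phi> x)) (\<phi> ` W)"
  shows "f \<in> smooth_fun A"
  unfolding smooth_fun_def mem_Collect_eq
proof (rule smooth_map_if_local[OF smooth_manifold_axioms smooth_manifold_real_atlas])
  fix p
  obtain U \<phi> W where *: "(U, \<phi>) \<in> A" "open W" "p \<in> W" "W \<subseteq> U"
    "smooth_on (\<lambda>x. f (inv_into U \<phi> x)) (\<phi> ` W)"
    using assms[of p] by blast
  show "\<exists>U \<phi> V \<psi> W. (U, \<phi>) \<in> A \<and> (V, \<psi>) \<in> real_atlas \<and> open W \<and> p \<in> W \<and> W \<subseteq> U \<and> f ` W \<subseteq> V \<and>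
      smooth_on (\<lambda>x. \<psi> (f (inv_into U \<phi> x))) (\<phi> ` W)"
    using * by (intro exI[of _ U] exI[of _ \<phi>] exI[of _ UNIV] exI[of _ "\<lambda>x. x"] exI[of _ W])
      (simp add: real_atlas_def)
qed

lemma smooth_fun_if_charts:
  assumes "\<And>U \<phi>. (U, \<phi>) \<in> A \<Longrightarrow> smooth_on (\<lambda>x. f (inv_into U \<phi> x)) (\<phi> ` U)"
  shows "f \<in> smooth_fun A"
proof (rule smooth_fun_if_local)
  fix p
  obtain U \<phi> where "(U, \<phi>) \<in> A" "p \<in> U" by (rule chart_at)
  then show "\<exists>U \<phi> W. (U, \<phi>) \<in> A \<and> open W \<and> p \<in> W \<and> W \<subseteq> U \<and>
      smooth_on (\<lambda>x. f (inv_into U \<phi> x)) (\<phi> ` W)"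
    using assms[of U \<phi>] chart_open[of U \<phi>] by (intro exI[of _ U] exI[of _ \<phi>]) simp
qed

lemma chart_range_open: "(U, \<phi>) \<in> A \<Longrightarrow> open (\<phi> ` U)"
  using chart_image_open chart_open by blast

lemma smooth_fun_const: "(\<lambda>_. c) \<in> smooth_fun A"
  by (rule smooth_fun_if_charts) (rule smooth_on_const)

lemma smooth_fun_add: "f \<in> smooth_fun A \<Longrightarrow> g \<in> smooth_fun A \<Longrightarrow> (\<lambda>x. f x + g x) \<in> smooth_fun A"
  by (rule smooth_fun_if_charts) (intro smooth_on_add chart_range_open smooth_funD)

lemma smooth_fun_diff: "f \<in> smooth_fun A \<Longrightarrow> g \<in> smooth_fun A \<Longrightarrow> (\<lambda>x. f x - g x) \<in> smooth_fun A"
  by (rule smooth_fun_if_charts) (intro smooth_on_diff chart_range_open smooth_funD)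

lemma smooth_fun_mult: "f \<in> smooth_fun A \<Longrightarrow> g \<in> smooth_fun A \<Longrightarrow> (\<lambda>x. f x * g x) \<in> smooth_fun A"
  by (rule smooth_fun_if_charts) (intro smooth_on_mult chart_range_open smooth_funD)

lemma smooth_fun_sum:
  "(\<And>i. i \<in> I \<Longrightarrow> f i \<in> smooth_fun A) \<Longrightarrow> (\<lambda>x. \<Sum>i\<in>I. f i x) \<in> smooth_fun A"
  by (rule smooth_fun_if_charts) (intro smooth_on_sum chart_range_open smooth_funD)

lemmas smooth_fun_intros =
  smooth_fun_const smooth_fun_add smooth_fun_diff smooth_fun_mult smooth_fun_sum

lemma smooth_fun_compose:
  assumes "smooth_manifold B" "smooth_map A B s" "f \<in> smooth_fun B"
  shows "(\<lambda>x. f (s x)) \<in> smooth_fun A"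
  using smooth_map_compose[OF smooth_manifold_axioms assms(1) smooth_manifold_real_atlas assms(2)]
    assms(3) by (simp add: smooth_fun_def)

text \<open>The preimage of \<open>K\<close> under the chart is compact, hence closed because the
  manifold is Hausdorff. Its complement and the preimage of \<open>T\<close> are open and cover the
  manifold; on the first the extension is zero, on the second it is \<open>h\<close> read in the
  chart.\<close>

lemma smooth_fun_extend:
  assumes c: "(U, \<phi>) \<in> A" and K: "compact K" "K \<subseteq> T" and T: "open T" "T \<subseteq> \<phi> ` U"
    and h: "smooth_on h T" "\<And>x. x \<in> T - K \<Longrightarrow> h x = 0"
  shows "(\<lambda>p. if p \<in> U \<and> \<phi> p \<in> T then h (\<phi> p) else 0) \<in> smooth_fun A"
    (is "?E \<in> _")
proof (rule smooth_fun_if_local)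
  fix p
  show "\<exists>U \<phi> W. (U, \<phi>) \<in> A \<and> open W \<and> p \<in> W \<and> W \<subseteq> U \<and>
    smooth_on (\<lambda>x. ?E (inv_into U \<phi> x)) (\<phi> ` W)"
  proof (cases "p \<in> U \<and> \<phi> p \<in> T")
    case True
    define W where "W = \<phi> -` T \<inter> U"
    have "open W"
      using continuous_on_chart[OF c order_refl] chart_open[OF c] T(1)
      by (simp add: W_def continuous_on_open_vimage)
    moreover have "\<phi> ` W = T" using T(2) by (auto simp: W_def)
    moreover have "smooth_on (\<lambda>x. ?E (inv_into U \<phi> x)) T"
      using h(1) _ T(1) by (rule smooth_on_eq) (use T(2) c in auto)
    ultimately show ?thesis
      using c True by (intro exI[of _ U] exI[of _ \<phi>] exI[of _ W]) (auto simp: W_def)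
  next
    case False
    obtain V \<psi> where V: "(V, \<psi>) \<in> A" "p \<in> V" by (rule chart_at)
    define C where "C = inv_into U \<phi> ` K"
    have "compact C"
      unfolding C_def using K T(2) by (intro compact_continuous_image continuous_on_inv_chart[OF c]) auto
    then have "closed C" by (rule compact_imp_closed)
    have "inv_into U \<phi> x \<in> U \<and> \<phi> (inv_into U \<phi> x) \<in> T" if "x \<in> K" for x
      using that K(2) T(2) by (simp add: subset_iff inv_into_into f_inv_into_f)
    then have pC: "p \<notin> C" using False by (auto simp: C_def)
    define W where "W = V - C"
    have W: "open W" "p \<in> W" "W \<subseteq> V"
      using chart_open[OF V(1)] V pC \<open>closed C\<close> by (auto simp: W_def)
    have "0 = ?E m" if "m \<in> W" for m
    proof (cases "m \<in> U \<and> \<phi> m \<in> T")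
      case True
      have "\<phi> m \<notin> K"
      proof
        assume "\<phi> m \<in> K"
        then have "inv_into U \<phi> (\<phi> m) \<in> C" by (auto simp: C_def)
        then show False using that True c by (simp add: W_def)
      qed
      then show ?thesis using True h(2) by simp
    qed auto
    then have zero: "0 = ?E (inv_into V \<psi> x)" if "x \<in> \<psi> ` W" for x
      using that W(3) V(1) by (simp add: image_iff subset_iff) (metis chart_inv)
    have "smooth_on (\<lambda>x. ?E (inv_into V \<psi> x)) (\<psi> ` W)"
      using smooth_on_const zero chart_image_open[OF V(1) W(1,3)] by (rule smooth_on_eq)
    then show ?thesis using V W by blast
  qed
qed

section \<open>Derivations at a point\<close>

lemma tangent_add:
  "v \<in> tangent_space A p \<Longrightarrow> f \<in> smooth_fun A \<Longrightarrow> g \<in> smooth_fun A \<Longrightarrow> v (\<lambda>x. f x + g x) = v f + v g"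
  by (simp add: tangent_space_def plus_fun_def)

lemma tangent_mult:
  "v \<in> tangent_space A p \<Longrightarrow> f \<in> smooth_fun A \<Longrightarrow> g \<in> smooth_fun A \<Longrightarrow>
    v (\<lambda>x. f x * g x) = v f * g p + f p * v g"
  by (simp add: tangent_space_def times_fun_def)

lemma tangent_scale:
  "v \<in> tangent_space A p \<Longrightarrow> f \<in> smooth_fun A \<Longrightarrow> v (\<lambda>x. c * f x) = c * v f"
  by (simp add: tangent_space_def)

lemma tangent_not_smooth: "v \<in> tangent_space A p \<Longrightarrow> f \<notin> smooth_fun A \<Longrightarrow> v f = 0"
  by (simp add: tangent_space_def)

lemma tangent_const:
  assumes "v \<in> tangent_space A p"
  shows "v (\<lambda>_. c) = 0"
proof -
  have "v (\<lambda>_. 1 * 1) = v (\<lambda>_. 1) * 1 + 1 * v (\<lambda>_. 1)"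
    using tangent_mult[OF assms smooth_fun_const smooth_fun_const] .
  then have "v (\<lambda>_. 1) = 0" by simp
  then show ?thesis using tangent_scale[OF assms smooth_fun_const, of c 1] by simp
qed

lemma tangent_diff:
  assumes "v \<in> tangent_space A p" "f \<in> smooth_fun A" "g \<in> smooth_fun A"
  shows "v (\<lambda>x. f x - g x) = v f - v g"
  using tangent_add[OF assms(1) smooth_fun_diff[OF assms(2,3)] assms(3)] by simp

lemma tangent_sum:
  assumes "v \<in> tangent_space A p" "\<And>i. i \<in> I \<Longrightarrow> f i \<in> smooth_fun A"
  shows "v (\<lambda>x. \<Sum>i\<in>I. f i x) = (\<Sum>i\<in>I. v (f i))"
  using assms(2)
proof (induction I rule: infinite_finite_induct)
  case (insert i I)
  then show ?case
    using tangent_add[OF assms(1), of "f i" "\<lambda>x. \<Sum>i\<in>I. f i x"] by (simp add: smooth_fun_sum)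
qed (simp_all add: tangent_const[OF assms(1)])

text \<open>
  The bump \<open>\<beta>\<close> need not be constant near \<open>p\<close>: multiplying by it only has to make the coordinate
  functions and the Hadamard quotients globally defined, and its value is divided out afterwards.
\<close>

lemma tangent_vector_coordinates:
  assumes B: "parseval_frame (B :: 'e set)" and c: "(U, \<phi>) \<in> A" and p: "p \<in> U"
  obtains W \<beta> \<xi> where "open W" "p \<in> W" "W \<subseteq> U" "\<beta> \<in> smooth_fun A" "\<And>b. \<xi> b \<in> smooth_fun A"
    and "\<And>q. q \<in> W \<Longrightarrow> \<beta> q \<noteq> 0"
    and "\<And>q v f. q \<in> W \<Longrightarrow> v \<in> tangent_space A q \<Longrightarrow> f \<in> smooth_fun A \<Longrightarrow>
      v f = (\<Sum>b\<in>B. (v (\<xi> b) - (\<phi> q \<bullet> b) * v \<beta>) / \<beta> q *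
        frechet_derivative (\<lambda>x. f (inv_into U \<phi> x)) (at (\<phi> q)) b)"
proof -
  obtain r where r: "r > 0" "ball (\<phi> p) r \<subseteq> \<phi> ` U"
    using chart_range_open[OF c] p open_contains_ball by blast
  define K where "K = cball (\<phi> p) (r / 2)"
  define T where "T = ball (\<phi> p) r"
  have K: "compact K" "K \<subseteq> T"
    using parseval_frame_imp_compact_cball[OF B] r(1) by (auto simp: K_def T_def)
  have T: "open T" "convex T" "T \<subseteq> \<phi> ` U" using r by (auto simp: T_def)
  obtain \<beta>0 :: "'e \<Rightarrow> real" where \<beta>0: "smooth_on \<beta>0 UNIV" "\<And>x. x \<in> ball (\<phi> p) (r / 2) \<Longrightarrow> \<beta>0 x \<noteq> 0"
    "\<And>x. x \<notin> ball (\<phi> p) (r / 2) \<Longrightarrow> \<beta>0 x = 0"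
    using smooth_bump[OF half_gt_zero[OF r(1)], of "\<phi> p"] by blast
  have \<beta>0_T: "smooth_on \<beta>0 T" using \<beta>0(1) by (rule smooth_on_mono) simp
  have \<beta>0_K: "\<beta>0 x = 0" if "x \<in> T - K" for x using that by (intro \<beta>0(3)) (auto simp: K_def)
  \<comment> \<open>Extension by zero of a function on the coordinate ball \<open>T\<close>. It is
    smooth on the manifold once a factor \<open>\<beta>0\<close>, which vanishes off
    \<open>K\<close>, is present.\<close>
  define E where "E h m = (if m \<in> U \<and> \<phi> m \<in> T then h (\<phi> m) else 0)" for h :: "'e \<Rightarrow> real" and m
  have E: "E (\<lambda>x. \<beta>0 x * h x) \<in> smooth_fun A" if "smooth_on h T" for h
    unfolding E_def using that \<beta>0_T \<beta>0_K T
    by (intro smooth_fun_extend[OF c K] smooth_on_mult) auto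
  define \<beta> where "\<beta> = E \<beta>0"
  define \<xi> where "\<xi> b = E (\<lambda>x. \<beta>0 x * (x \<bullet> b))" for b
  define W where "W = \<phi> -` ball (\<phi> p) (r / 2) \<inter> U"
  have \<beta>: "\<beta> \<in> smooth_fun A" using E[OF smooth_on_const[of 1]] by (simp add: \<beta>_def)
  have \<xi>: "\<xi> b \<in> smooth_fun A" for b
    unfolding \<xi>_def by (intro E smooth_on_linear bounded_linear_inner_left)
  have W: "\<phi> q \<in> T" "q \<in> U" "\<beta> q = \<beta>0 (\<phi> q)" "\<beta> q \<noteq> 0" if "q \<in> W" for q
    using that r(1) \<beta>0(2) by (auto simp: W_def T_def \<beta>_def E_def)
  show thesis
  proof (rule that[OF _ _ _ \<beta> \<xi>])
    show "open W"
      using continuous_on_chart[OF c order_refl] chart_open[OF c]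
      by (simp add: W_def continuous_on_open_vimage)
    show "p \<in> W" "W \<subseteq> U" using p r by (auto simp: W_def)
    show "\<beta> q \<noteq> 0" if "q \<in> W" for q using W that by simp
    fix q v f assume q: "q \<in> W" and v: "v \<in> tangent_space A q" and f: "f \<in> smooth_fun A"
    define a where "a = \<phi> q"
    let ?F = "\<lambda>x. f (inv_into U \<phi> x)"
    have F: "smooth_on ?F T" using smooth_funD[OF f c] T(3) by (rule smooth_on_mono)
    \<comment> \<open>The Hadamard expansion is centred at the varying point
      \<open>\<phi> q\<close>, which convexity of \<open>T\<close> allows; hence \<open>W\<close>,
      \<open>\<beta>\<close> and \<open>\<xi>\<close> can be fixed before \<open>q\<close>,
      \<open>v\<close> and \<open>f\<close>.\<close>
    obtain g where g: "\<And>b. smooth_on (g b) T" "\<And>b. g b a = frechet_derivative ?F (at a) b"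
      and fg: "\<And>x. x \<in> T \<Longrightarrow> ?F x = ?F a + (\<Sum>b\<in>B. ((x - a) \<bullet> b) * g b x)"
      using Hadamard_lemma[OF B T(1,2) W(1)[OF q] F] unfolding a_def by blast
    \<comment> \<open>On the preimage of \<open>T\<close>, \<open>P b\<close> is
      \<open>\<beta>\<close> times the coordinate difference to \<open>a\<close> and
      \<open>Q b\<close> is \<open>\<beta>\<close> times the Hadamard quotient. As
      \<open>P b\<close> vanishes at \<open>q\<close>, the Leibniz rule leaves only
      \<open>v (P b) * Q b q\<close>.\<close>
    define P where "P b m = \<xi> b m - (a \<bullet> b) * \<beta> m" for b m
    define Q where "Q b = E (\<lambda>x. \<beta>0 x * g b x)" for b
    have P: "P b \<in> smooth_fun A" for b
      unfolding P_def by (intro smooth_fun_intros \<beta> \<xi>)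
    have Q: "Q b \<in> smooth_fun A" for b unfolding Q_def by (intro E g)
    have Pq: "P b q = 0" and Qq: "Q b q = \<beta> q * frechet_derivative ?F (at a) b" for b
      using W[OF q] g(2) by (simp_all add: P_def Q_def \<xi>_def E_def a_def)
    have vP: "v (P b) = v (\<xi> b) - (a \<bullet> b) * v \<beta>" for b
      unfolding P_def tangent_diff[OF v \<xi> smooth_fun_mult[OF smooth_fun_const \<beta>]]
      by (simp add: tangent_scale[OF v \<beta>])
    \<comment> \<open>Hadamard's formula as an identity of global functions: multiplied by the
      square of \<open>\<beta>\<close> it also holds off the preimage of \<open>T\<close>, where
      \<open>\<beta>\<close> and \<open>P b\<close> vanish. The first summand is a product of two
      functions vanishing at \<open>q\<close>, so \<open>v\<close> annihilates it.\<close>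
    have decomp: "(\<beta> q)\<^sup>2 * (f m - f q) =
        ((\<beta> q)\<^sup>2 - \<beta> m * \<beta> m) * (f m - f q) + (\<Sum>b\<in>B. P b m * Q b m)" for m
    proof (cases "m \<in> U \<and> \<phi> m \<in> T")
      case True
      have "f m - f q = (\<Sum>b\<in>B. ((\<phi> m - a) \<bullet> b) * g b (\<phi> m))"
        using fg[of "\<phi> m"] True W[OF q] c by (simp add: a_def)
      moreover have "P b m * Q b m = \<beta> m * \<beta> m * (((\<phi> m - a) \<bullet> b) * g b (\<phi> m))" for b
        using True by (simp add: P_def Q_def \<xi>_def \<beta>_def E_def algebra_simps)
      ultimately have "(\<Sum>b\<in>B. P b m * Q b m) = \<beta> m * \<beta> m * (f m - f q)"
        by (simp only: sum_distrib_left)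
      then show ?thesis by (simp add: algebra_simps)
    next
      case False
      then have "\<beta> m = 0" "P b m = 0" for b by (auto simp: P_def \<xi>_def \<beta>_def E_def)
      then show ?thesis by simp
    qed
    have sm: "(\<lambda>m. f m - f q) \<in> smooth_fun A" "(\<lambda>m. (\<beta> q)\<^sup>2 - \<beta> m * \<beta> m) \<in> smooth_fun A"
      by (intro smooth_fun_intros f \<beta>)+
    have "(\<beta> q)\<^sup>2 * v f = v (\<lambda>m. (\<beta> q)\<^sup>2 * (f m - f q))"
      by (simp add: tangent_scale[OF v sm(1)] tangent_diff[OF v f smooth_fun_const] tangent_const[OF v])
    also have "\<dots> = v (\<lambda>m. ((\<beta> q)\<^sup>2 - \<beta> m * \<beta> m) * (f m - f q) + (\<Sum>b\<in>B. P b m * Q b m))"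
      by (simp add: decomp)
    also have "\<dots> = v (\<lambda>m. ((\<beta> q)\<^sup>2 - \<beta> m * \<beta> m) * (f m - f q)) + (\<Sum>b\<in>B. v (\<lambda>m. P b m * Q b m))"
      by (subst tangent_add[OF v]) (auto intro!: smooth_fun_intros sm P Q f \<beta> tangent_sum[OF v])
    also have "v (\<lambda>m. ((\<beta> q)\<^sup>2 - \<beta> m * \<beta> m) * (f m - f q)) = 0"
      using tangent_mult[OF v sm(2,1)] by (simp add: power2_eq_square)
    also have "0 + (\<Sum>b\<in>B. v (\<lambda>m. P b m * Q b m)) = (\<Sum>b\<in>B. v (P b) * Q b q)"
      using tangent_mult[OF v P Q] by (simp add: Pq)
    finally have "v f = (\<Sum>b\<in>B. v (P b) * Q b q) / (\<beta> q)\<^sup>2"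
      using W(4)[OF q] by (simp add: field_simps)
    also have "\<dots> = (\<Sum>b\<in>B. v (P b) / \<beta> q * frechet_derivative ?F (at a) b)"
      using W(4)[OF q] by (auto simp: sum_divide_distrib Qq power2_eq_square intro!: sum.cong)
    finally show "v f = (\<Sum>b\<in>B. (v (\<xi> b) - (\<phi> q \<bullet> b) * v \<beta>) / \<beta> q *
        frechet_derivative ?F (at (\<phi> q)) b)"
      by (simp add: vP a_def)
  qed
qed

end

text \<open>The hypothesis on \<open>v\<close> concerns fixed functions \<open>h\<close>, but here
  the function varies with \<open>g\<close>. The coordinate expansion separates the two: its
  coefficients come from values of \<open>v g\<close> on fixed functions, and its partial
  derivatives are those of \<open>F\<close> in the second variable, smooth in both variables
  together. The base point \<open>s g\<close> will be constant for left invariant fields and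
  \<open>g\<close> itself for the coefficients of a field.\<close>

lemma smooth_fun_fibre_derivative:
  assumes A: "smooth_manifold (A :: ('a::{t2_space,second_countable_topology}, 'e::real_inner) atlas)"
    and C: "smooth_manifold (C :: ('c::{t2_space,second_countable_topology}, 'g::real_inner) atlas)"
    and s: "smooth_map C A s" and v: "\<And>g. v g \<in> tangent_space A (s g)"
    and sm: "\<And>h. h \<in> smooth_fun A \<Longrightarrow> (\<lambda>g. v g h) \<in> smooth_fun C"
    and F: "F \<in> smooth_fun (prod_atlas C A)"
  shows "(\<lambda>g. v g (\<lambda>x. F (g, x))) \<in> smooth_fun C"
proof (rule smooth_manifold.smooth_fun_if_local[OF C])
  interpret A: smooth_manifold A by fact
  interpret C: smooth_manifold C by fact
  interpret CA: smooth_manifold "prod_atlas C A" by (rule smooth_manifold_prod_atlas) fact+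
  obtain B :: "'e set" where B: "parseval_frame B" by (rule A.frame_exists)
  obtain BC :: "'g set" where BC: "parseval_frame BC" by (rule C.frame_exists)
  obtain BP :: "('g \<times> 'e) set" where BP: "parseval_frame BP"
    using parseval_frame_Times[OF BC B] by blast
  fix p
  obtain U \<phi> where U: "(U, \<phi>) \<in> C" "p \<in> U" by (rule C.chart_at)
  obtain V \<psi> where V: "(V, \<psi>) \<in> A" "s p \<in> V" by (rule A.chart_at)
  obtain W \<beta> \<xi> where W: "open W" "s p \<in> W" "W \<subseteq> V" and \<beta>\<xi>: "\<beta> \<in> smooth_fun A" "\<And>b. \<xi> b \<in> smooth_fun A"
    and \<beta>0: "\<And>q. q \<in> W \<Longrightarrow> \<beta> q \<noteq> 0"
    and coord: "\<And>q v f. q \<in> W \<Longrightarrow> v \<in> tangent_space A q \<Longrightarrow> f \<in> smooth_fun A \<Longrightarrow>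
      v f = (\<Sum>b\<in>B. (v (\<xi> b) - (\<psi> q \<bullet> b) * v \<beta>) / \<beta> q *
        frechet_derivative (\<lambda>x. f (inv_into V \<psi> x)) (at (\<psi> q)) b)"
    using A.tangent_vector_coordinates[OF B V] by blast
  define N where "N = U \<inter> s -` W"
  have N: "open N" "p \<in> N" "N \<subseteq> U" "N \<subseteq> s -` W"
    using C.chart_open[OF U(1)] smooth_map_open_vimage[OF s W(1)] U W by (auto simp: N_def)
  have opN: "open (\<phi> ` N)" using C.chart_image_open[OF U(1)] N by blast
  have opV: "open (\<psi> ` V)" by (rule A.chart_range_open[OF V(1)])
  define \<sigma> where "\<sigma> x = \<psi> (s (inv_into U \<phi> x))" for x
  define F' where "F' z = F (inv_into (U \<times> V) (map_prod \<phi> \<psi>) z)" for z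
  have F': "smooth_on F' (\<phi> ` U \<times> \<psi> ` V)"
    using CA.smooth_funD[OF F prod_atlasI[OF U(1) V(1)]] by (simp add: F'_def[abs_def] map_prod_image)
  have F'_eq: "F' (x, y) = F (inv_into U \<phi> x, inv_into V \<psi> y)" if "x \<in> \<phi> ` U" "y \<in> \<psi> ` V" for x y
    using that inv_into_prod_chart[OF C A U(1) V(1), of "(x, y)"] by (simp add: F'_def)
  have fibre: "(\<lambda>x. F (g, x)) \<in> smooth_fun A" for g
    by (rule A.smooth_fun_compose[OF CA.smooth_manifold_axioms smooth_map_Pair[OF A C A] F])
      (intro smooth_map_const smooth_map_ident A C)+
  have \<sigma>: "smooth_on \<sigma> (\<phi> ` N)"
    using smooth_mapD[OF s U(1) V(1)] unfolding \<sigma>_def[abs_def]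
    by (rule smooth_on_mono) (use W N in blast)
  have \<sigma>V: "\<sigma> x \<in> \<psi> ` V" if "x \<in> \<phi> ` N" for x
    using that N W U(1) by (auto simp: \<sigma>_def subset_iff)
  have restrict: "smooth_on (\<lambda>x. f (inv_into U \<phi> x)) (\<phi> ` N)" if "f \<in> smooth_fun C" for f
    using C.smooth_funD[OF that U(1)] by (rule smooth_on_mono) (use N in auto)
  \<comment> \<open>The derivative in the second variable is the total derivative of
    \<open>F'\<close> in direction \<open>(0, b)\<close>; in this form its smoothness in
    \<open>x\<close> follows from that of \<open>F'\<close> and \<open>\<sigma>\<close>.\<close>
  have deriv: "frechet_derivative (\<lambda>y. F (inv_into U \<phi> x, inv_into V \<psi> y)) (at (\<sigma> x)) b =
      frechet_derivative F' (at (x, \<sigma> x)) (0, b)" if x: "x \<in> \<phi> ` N" for x b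
  proof -
    have xU: "x \<in> \<phi> ` U" using x N by auto
    have "((\<lambda>y. (x, y)) has_derivative (\<lambda>b. (0, b))) (at (\<sigma> x))"
      by (auto intro!: derivative_eq_intros)
    from has_derivative_compose[OF this smooth_on_imp_has_derivative[OF F']]
    have "((\<lambda>y. F' (x, y)) has_derivative (\<lambda>b. frechet_derivative F' (at (x, \<sigma> x)) (0, b))) (at (\<sigma> x))"
      using xU \<sigma>V[OF x] by simp
    then have "((\<lambda>y. F (inv_into U \<phi> x, inv_into V \<psi> y)) has_derivative
        (\<lambda>b. frechet_derivative F' (at (x, \<sigma> x)) (0, b))) (at (\<sigma> x))"
      by (rule has_derivative_transform_within_open[OF _ opV \<sigma>V[OF x]]) (simp add: F'_eq xU)
    from frechet_derivative_at[OF this] show ?thesis by metis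
  qed
  let ?G = "\<lambda>x. \<Sum>b\<in>B. (v (inv_into U \<phi> x) (\<xi> b) - (\<sigma> x \<bullet> b) * v (inv_into U \<phi> x) \<beta>)
      / \<beta> (s (inv_into U \<phi> x)) * frechet_derivative F' (at (x, \<sigma> x)) (0, b)"
  have "smooth_on ?G (\<phi> ` N)"
  proof (rule smooth_on_sum[OF opN])
    fix b
    have "smooth_on (\<lambda>x. frechet_derivative F' (at (x, \<sigma> x)) (0, b)) (\<phi> ` N)"
      by (rule smooth_on_compose[OF BP opN open_Times[OF C.chart_range_open[OF U(1)] opV] _
            smooth_on_frechet_derivative[OF F'] smooth_on_Pair[OF opN smooth_on_linear[OF bounded_linear_ident] \<sigma>]])
        (use N \<sigma>V in auto)
    moreover have "\<beta> (s (inv_into U \<phi> x)) \<noteq> 0" if "x \<in> \<phi> ` N" for x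
      using that N U(1) \<beta>0 by (auto simp: subset_iff)
    ultimately show "smooth_on (\<lambda>x. (v (inv_into U \<phi> x) (\<xi> b) - (\<sigma> x \<bullet> b) * v (inv_into U \<phi> x) \<beta>)
      / \<beta> (s (inv_into U \<phi> x)) * frechet_derivative F' (at (x, \<sigma> x)) (0, b)) (\<phi> ` N)"
      by (intro smooth_on_mult smooth_on_divide smooth_on_diff opN
          smooth_on_linear_comp[OF bounded_linear_inner_left] \<sigma>
          restrict[OF sm[OF \<beta>\<xi>(1)]] restrict[OF sm[OF \<beta>\<xi>(2)]]
          restrict[OF C.smooth_fun_compose[OF A s \<beta>\<xi>(1)]])
  qed
  moreover have "?G x = v (inv_into U \<phi> x) (\<lambda>y. F (inv_into U \<phi> x, y))" if x: "x \<in> \<phi> ` N" for x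
  proof -
    have "s (inv_into U \<phi> x) \<in> W" using x N U(1) by (auto simp: subset_iff)
    from coord[OF this v fibre] show ?thesis
      using deriv[OF x] by (simp flip: \<sigma>_def)
  qed
  ultimately have "smooth_on (\<lambda>x. v (inv_into U \<phi> x) (\<lambda>y. F (inv_into U \<phi> x, y))) (\<phi> ` N)"
    using opN by (rule smooth_on_eq)
  then show "\<exists>U \<phi> W. (U, \<phi>) \<in> C \<and> open W \<and> p \<in> W \<and> W \<subseteq> U \<and>
      smooth_on (\<lambda>x. v (inv_into U \<phi> x) (\<lambda>y. F (inv_into U \<phi> x, y))) (\<phi> ` W)"
    using U(1) N by blast
qed

section \<open>Connections and the Ricci identity\<close>

lemma scale_field_diff: "scale_field f (X - Y) = scale_field f X - scale_field f Y"
  by (simp add: scale_field_def fun_eq_iff algebra_simps)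

lemma lie_bracket_commute: "lie_bracket Y X = - lie_bracket X Y"
  by (simp add: lie_bracket_def fun_eq_iff)

context smooth_manifold
begin

lemma tangent_spaceI:
  assumes "\<And>f g. f \<in> smooth_fun A \<Longrightarrow> g \<in> smooth_fun A \<Longrightarrow> v (\<lambda>x. f x + g x) = v f + v g"
    and "\<And>f g. f \<in> smooth_fun A \<Longrightarrow> g \<in> smooth_fun A \<Longrightarrow> v (\<lambda>x. f x * g x) = v f * g p + f p * v g"
    and "\<And>f c. f \<in> smooth_fun A \<Longrightarrow> v (\<lambda>x. c * f x) = c * v f"
    and "\<And>f. f \<notin> smooth_fun A \<Longrightarrow> v f = 0"
  shows "v \<in> tangent_space A p"
  using assms by (simp add: tangent_space_def plus_fun_def times_fun_def)

lemma vector_field_tangent: "X \<in> vector_fields A \<Longrightarrow> X p \<in> tangent_space A p"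
  by (simp add: vector_fields_def)

lemma vector_field_smooth: "X \<in> vector_fields A \<Longrightarrow> f \<in> smooth_fun A \<Longrightarrow> (\<lambda>p. X p f) \<in> smooth_fun A"
  by (simp add: vector_fields_def)

lemma vector_fieldsI:
  "(\<And>p. X p \<in> tangent_space A p) \<Longrightarrow> (\<And>f. f \<in> smooth_fun A \<Longrightarrow> (\<lambda>p. X p f) \<in> smooth_fun A) \<Longrightarrow>
    X \<in> vector_fields A"
  by (simp add: vector_fields_def)

lemma vector_field_not_smooth: "X \<in> vector_fields A \<Longrightarrow> f \<notin> smooth_fun A \<Longrightarrow> X p f = 0"
  using vector_field_tangent tangent_not_smooth by blast

lemmas vector_field_rules =
  vector_field_smooth
  tangent_add[OF vector_field_tangent] tangent_diff[OF vector_field_tangent]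
  tangent_mult[OF vector_field_tangent] tangent_scale[OF vector_field_tangent]
  tangent_const[OF vector_field_tangent] vector_field_not_smooth

lemma vector_fields_add:
  assumes "X \<in> vector_fields A" "Y \<in> vector_fields A"
  shows "X + Y \<in> vector_fields A"
  by (intro vector_fieldsI tangent_spaceI)
    (simp_all add: vector_field_rules[OF assms(1)] vector_field_rules[OF assms(2)]
      smooth_fun_add algebra_simps)

lemma vector_fields_diff:
  assumes "X \<in> vector_fields A" "Y \<in> vector_fields A"
  shows "X - Y \<in> vector_fields A"
  by (intro vector_fieldsI tangent_spaceI)
    (simp_all add: vector_field_rules[OF assms(1)] vector_field_rules[OF assms(2)]
      smooth_fun_diff algebra_simps)

lemma vector_fields_scale:
  assumes "f \<in> smooth_fun A" "X \<in> vector_fields A"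
  shows "scale_field f X \<in> vector_fields A"
  by (intro vector_fieldsI tangent_spaceI)
    (simp_all add: scale_field_def vector_field_rules[OF assms(2)] assms(1)
      smooth_fun_mult algebra_simps)

lemma vector_fields_lie_bracket:
  assumes "X \<in> vector_fields A" "Y \<in> vector_fields A"
  shows "lie_bracket X Y \<in> vector_fields A"
  by (intro vector_fieldsI tangent_spaceI)
    (simp_all add: lie_bracket_def vector_field_rules[OF assms(1)] vector_field_rules[OF assms(2)]
      smooth_fun_add smooth_fun_mult smooth_fun_diff smooth_fun_const right_diff_distrib left_diff_distrib)

lemma vector_fields_zero: "0 \<in> vector_fields A"
  by (intro vector_fieldsI tangent_spaceI) (auto intro: smooth_fun_const)

lemma vector_fields_sum:
  "(\<And>i. i \<in> I \<Longrightarrow> X i \<in> vector_fields A) \<Longrightarrow> sum X I \<in> vector_fields A"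
  by (induction I rule: infinite_finite_induct) (auto intro: vector_fields_zero vector_fields_add)

lemmas vector_fields_intros =
  vector_fields_add vector_fields_diff vector_fields_scale vector_fields_lie_bracket
  vector_fields_sum smooth_fun_const

text \<open>Vector fields vanish on non-smooth functions by the convention in
  \<open>tangent_space\<close>, so nothing is left to compare there.\<close>

lemma vfield_eqI:
  assumes "X \<in> vector_fields A" "Y \<in> vector_fields A" "\<And>p f. f \<in> smooth_fun A \<Longrightarrow> X p f = Y p f"
  shows "X = Y"
  using assms vector_field_not_smooth by (metis ext)

lemma lie_bracket_add_left:
  assumes "X \<in> vector_fields A" "X' \<in> vector_fields A" "Y \<in> vector_fields A"
  shows "lie_bracket (X + X') Y = lie_bracket X Y + lie_bracket X' Y"
  using assms
  by (intro vfield_eqI vector_fields_intros)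
    (simp_all add: lie_bracket_def vector_field_rules[OF assms(1)] vector_field_rules[OF assms(2)]
      vector_field_rules[OF assms(3)])

lemma lie_bracket_scale_left:
  assumes "f \<in> smooth_fun A" "X \<in> vector_fields A" "Y \<in> vector_fields A"
  shows "lie_bracket (scale_field f X) Y =
    scale_field f (lie_bracket X Y) - scale_field (\<lambda>p. Y p f) X"
  using assms vector_field_smooth[OF assms(3,1)]
  by (intro vfield_eqI vector_fields_intros)
    (simp_all add: lie_bracket_def scale_field_def vector_field_rules[OF assms(2)]
      vector_field_rules[OF assms(3)] algebra_simps)

lemma lie_bracket_diff:
  assumes "X \<in> vector_fields A" "X' \<in> vector_fields A" "Y \<in> vector_fields A"
  shows "lie_bracket (X - X') Y = lie_bracket X Y - lie_bracket X' Y"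
    and "lie_bracket Y (X - X') = lie_bracket Y X - lie_bracket Y X'"
proof -
  show *: "lie_bracket (X - X') Y = lie_bracket X Y - lie_bracket X' Y"
    using lie_bracket_add_left[OF vector_fields_diff[OF assms(1,2)] assms(2,3)]
    by (simp add: eq_diff_eq)
  show "lie_bracket Y (X - X') = lie_bracket Y X - lie_bracket Y X'"
    by (simp add: lie_bracket_commute[of Y] *)
qed

text \<open>Evaluated on a function, both sides expand into compositions of three derivations that
  match term by term. The identity is oriented so that bracketing with \<open>X\<close> appears as a
  derivation of the bracket.\<close>

lemma lie_bracket_jacobi:
  assumes "X \<in> vector_fields A" "Y \<in> vector_fields A" "Z \<in> vector_fields A"
  shows "lie_bracket X (lie_bracket Y Z) = lie_bracket (lie_bracket X Y) Z + lie_bracket Y (lie_bracket X Z)"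
  using assms
  by (intro vfield_eqI vector_fields_intros)
    (simp_all add: lie_bracket_def vector_field_rules[OF assms(1)] vector_field_rules[OF assms(2)]
      vector_field_rules[OF assms(3)])

text \<open>Phrased for a map of one field, so that each of the five slots of
  \<open>curvature_action\<close> can be treated with the others held fixed.\<close>

definition tensorial :: "('a vfield \<Rightarrow> 'a vfield) \<Rightarrow> bool" where
  "tensorial T \<longleftrightarrow>
    (\<forall>X\<in>vector_fields A. \<forall>Y\<in>vector_fields A. T (X + Y) = T X + T Y) \<and>
    (\<forall>f\<in>smooth_fun A. \<forall>X\<in>vector_fields A. T (scale_field f X) = scale_field f (T X))"

lemma tensorial_eq_0:
  assumes T: "tensorial T"
    and X: "X = (\<Sum>i\<in>I. scale_field (a i) (L i))" "\<And>i. i \<in> I \<Longrightarrow> a i \<in> smooth_fun A"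
      "\<And>i. i \<in> I \<Longrightarrow> L i \<in> vector_fields A"
    and zero: "\<And>i. i \<in> I \<Longrightarrow> T (L i) = 0"
  shows "T X = 0"
proof -
  have add: "T (X + Y) = T X + T Y" if "X \<in> vector_fields A" "Y \<in> vector_fields A" for X Y
    using T that by (simp add: tensorial_def)
  have T0: "T 0 = 0"
    using T vector_fields_zero unfolding tensorial_def by (metis add_cancel_right_right)
  have "T (\<Sum>i\<in>I. scale_field (a i) (L i)) = 0"
    using X(2,3) zero
  proof (induction I rule: infinite_finite_induct)
    case (insert i I)
    have "T (scale_field (a i) (L i)) = scale_field (a i) (T (L i))"
      using insert.prems T by (simp add: tensorial_def)
    moreover have "scale_field (a i) (T (L i)) = 0"
      using insert.prems(3) by (simp add: scale_field_def fun_eq_iff)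
    moreover have "T (scale_field (a i) (L i) + (\<Sum>i\<in>I. scale_field (a i) (L i))) =
        T (scale_field (a i) (L i)) + T (\<Sum>i\<in>I. scale_field (a i) (L i))"
      by (rule add) (use insert.prems in \<open>auto intro!: vector_fields_intros\<close>)
    moreover have "T (\<Sum>i\<in>I. scale_field (a i) (L i)) = 0"
      by (rule insert.IH) (use insert.prems in auto)
    ultimately show ?case by (simp only: sum.insert[OF insert.hyps] add_0_right)
  qed (simp_all add: T0)
  then show ?thesis by (simp add: X(1))
qed

end

text \<open>The tensor usually written \<open>R \<cdot> R\<close>, evaluated at the fields. It
  involves no differentiation, so it can be compared between connections with the same
  curvature.\<close>

definition curvature_action ::
    "('a vfield \<Rightarrow> 'a vfield \<Rightarrow> 'a vfield \<Rightarrow> 'a vfield) \<Rightarrow>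
      'a vfield \<Rightarrow> 'a vfield \<Rightarrow> 'a vfield \<Rightarrow> 'a vfield \<Rightarrow> 'a vfield \<Rightarrow> 'a vfield" where
  "curvature_action K X Y U V W =
    K X Y (K U V W) - K (K X Y U) V W - K U (K X Y V) W - K U V (K X Y W)"

section \<open>Linear connections and tensoriality of the curvature\<close>

locale manifold_connection = smooth_manifold A
  for A :: "('a::{t2_space,second_countable_topology}, 'e::real_inner) atlas" +
  fixes D :: "'a connection"
  assumes linear_connection: "linear_connection A D"
begin

lemma D_closed: "X \<in> vector_fields A \<Longrightarrow> Y \<in> vector_fields A \<Longrightarrow> D X Y \<in> vector_fields A"
  using linear_connection by (simp add: linear_connection_def)

lemma D_add_left: "X \<in> vector_fields A \<Longrightarrow> X' \<in> vector_fields A \<Longrightarrow> Y \<in> vector_fields A \<Longrightarrow>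
    D (X + X') Y = D X Y + D X' Y"
  using linear_connection by (simp add: linear_connection_def)

lemma D_scale_left: "f \<in> smooth_fun A \<Longrightarrow> X \<in> vector_fields A \<Longrightarrow> Y \<in> vector_fields A \<Longrightarrow>
    D (scale_field f X) Y = scale_field f (D X Y)"
  using linear_connection by (simp add: linear_connection_def)

lemma D_add_right: "X \<in> vector_fields A \<Longrightarrow> Y \<in> vector_fields A \<Longrightarrow> Y' \<in> vector_fields A \<Longrightarrow>
    D X (Y + Y') = D X Y + D X Y'"
  using linear_connection by (simp add: linear_connection_def)

lemma D_scale_right: "f \<in> smooth_fun A \<Longrightarrow> X \<in> vector_fields A \<Longrightarrow> Y \<in> vector_fields A \<Longrightarrow>
    D X (scale_field f Y) = scale_field (\<lambda>p. X p f) Y + scale_field f (D X Y)"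
  using linear_connection by (simp add: linear_connection_def)

lemma D_diff_left:
  assumes "X \<in> vector_fields A" "X' \<in> vector_fields A" "Y \<in> vector_fields A"
  shows "D (X - X') Y = D X Y - D X' Y"
  using D_add_left[OF vector_fields_diff[OF assms(1,2)] assms(2,3)] by (simp add: eq_diff_eq)

lemma D_diff_right:
  assumes "X \<in> vector_fields A" "Y \<in> vector_fields A" "Y' \<in> vector_fields A"
  shows "D X (Y - Y') = D X Y - D X Y'"
  using D_add_right[OF assms(1) vector_fields_diff[OF assms(2,3)] assms(3)] by (simp add: eq_diff_eq)

lemma D_scale_const_right: "X \<in> vector_fields A \<Longrightarrow> Y \<in> vector_fields A \<Longrightarrow>
    D X (scale_field (\<lambda>_. c) Y) = scale_field (\<lambda>_. c) (D X Y)"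
  by (simp add: D_scale_right smooth_fun_const vector_field_rules(6))
    (simp add: scale_field_def fun_eq_iff)

lemma curvature_closed: "X \<in> vector_fields A \<Longrightarrow> Y \<in> vector_fields A \<Longrightarrow> Z \<in> vector_fields A \<Longrightarrow>
    curvature D X Y Z \<in> vector_fields A"
  unfolding curvature_def by (intro vector_fields_intros D_closed)

text \<open>Antisymmetry will transfer linearity from the first slot to the second.\<close>

lemma curvature_commute:
  assumes "X \<in> vector_fields A" "Y \<in> vector_fields A" "Z \<in> vector_fields A"
  shows "curvature D Y X Z = - curvature D X Y Z"
proof -
  \<comment> \<open>Negation is reduced to differences: \<open>D 0 Z = 0\<close> comes from
    \<open>D (Z - Z) Z\<close>, and then \<open>- L\<close> is treated as
    \<open>0 - L\<close>.\<close>
  have "D (lie_bracket Y X) Z = - D (lie_bracket X Y) Z"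
    using D_diff_left[of 0 "lie_bracket X Y" Z] D_diff_left[of Z Z Z] assms
    by (simp add: vector_fields_intros vector_fields_zero lie_bracket_commute[of Y X])
  then show ?thesis by (simp add: curvature_def)
qed

lemma curvature_add_1:
  assumes "X \<in> vector_fields A" "X' \<in> vector_fields A" "Y \<in> vector_fields A" "Z \<in> vector_fields A"
  shows "curvature D (X + X') Y Z = curvature D X Y Z + curvature D X' Y Z"
  using assms by (simp add: curvature_def D_add_left D_add_right lie_bracket_add_left
      D_closed vector_fields_intros)

text \<open>Differentiating the factor \<open>f\<close> in
  \<open>D Y (scale_field f (D X Z))\<close> produces an extra term \<open>(Y f) D X Z\<close>,
  which the bracket \<open>[f X, Y] = f [X, Y] - (Y f) X\<close> compensates.\<close>

lemma curvature_scale_1: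
  assumes "f \<in> smooth_fun A" "X \<in> vector_fields A" "Y \<in> vector_fields A" "Z \<in> vector_fields A"
  shows "curvature D (scale_field f X) Y Z = scale_field f (curvature D X Y Z)"
  using assms vector_field_smooth[OF assms(3,1)]
  by (simp add: curvature_def D_scale_left D_scale_right lie_bracket_scale_left
      D_diff_left scale_field_diff D_closed vector_fields_intros)

lemma curvature_add_2:
  assumes "X \<in> vector_fields A" "Y \<in> vector_fields A" "Y' \<in> vector_fields A" "Z \<in> vector_fields A"
  shows "curvature D X (Y + Y') Z = curvature D X Y Z + curvature D X Y' Z"
  using assms by (simp add: curvature_commute[of _ X] curvature_add_1 vector_fields_intros)

lemma curvature_scale_2:
  assumes "f \<in> smooth_fun A" "X \<in> vector_fields A" "Y \<in> vector_fields A" "Z \<in> vector_fields A"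
  shows "curvature D X (scale_field f Y) Z = scale_field f (curvature D X Y Z)"
  using assms by (simp add: curvature_commute[of _ X] curvature_scale_1 vector_fields_intros)
    (simp add: scale_field_def fun_eq_iff)

lemma curvature_add_3:
  assumes "X \<in> vector_fields A" "Y \<in> vector_fields A" "Z \<in> vector_fields A" "Z' \<in> vector_fields A"
  shows "curvature D X Y (Z + Z') = curvature D X Y Z + curvature D X Y Z'"
  using assms by (simp add: curvature_def D_add_right D_closed vector_fields_intros)

text \<open>The terms with first derivatives of \<open>f\<close> are symmetric in \<open>X\<close>
  and \<open>Y\<close> and cancel; the second derivatives leave \<open>X (Y f) - Y (X f)\<close>,
  which the derivative along the bracket removes.\<close>

lemma curvature_scale_3:
  assumes "f \<in> smooth_fun A" "X \<in> vector_fields A" "Y \<in> vector_fields A" "Z \<in> vector_fields A"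
  shows "curvature D X Y (scale_field f Z) = scale_field f (curvature D X Y Z)"
proof -
  have "D X (D Y (scale_field f Z)) = scale_field (\<lambda>p. X p (\<lambda>q. Y q f)) Z
      + scale_field (\<lambda>p. Y p f) (D X Z) + scale_field (\<lambda>p. X p f) (D Y Z) + scale_field f (D X (D Y Z))"
    if "X \<in> vector_fields A" "Y \<in> vector_fields A" for X Y
    using assms that vector_field_smooth[OF that(2) assms(1)]
    by (simp add: D_scale_right D_add_right D_closed vector_fields_intros)
  note DD = this[OF assms(2,3)] this[OF assms(3,2)]
  show ?thesis
    using assms unfolding curvature_def DD
    by (simp add: D_scale_right vector_fields_intros)
      (simp add: lie_bracket_def scale_field_def fun_eq_iff algebra_simps)
qed

lemmas curvature_linear =
  curvature_add_1 curvature_add_2 curvature_add_3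
  curvature_scale_1 curvature_scale_2 curvature_scale_3

lemma curvature_action_tensorial:
  assumes "X \<in> vector_fields A" "Y \<in> vector_fields A"
    and "U \<in> vector_fields A" "V \<in> vector_fields A" "W \<in> vector_fields A"
  shows "tensorial (\<lambda>X. curvature_action (curvature D) X Y U V W)"
    and "tensorial (\<lambda>Y. curvature_action (curvature D) X Y U V W)"
    and "tensorial (\<lambda>U. curvature_action (curvature D) X Y U V W)"
    and "tensorial (\<lambda>V. curvature_action (curvature D) X Y U V W)"
    and "tensorial (\<lambda>W. curvature_action (curvature D) X Y U V W)"
  using assms unfolding tensorial_def curvature_action_def
  by (simp_all add: curvature_linear curvature_closed vector_fields_add vector_fields_scale
      scale_field_diff)

text \<open>The slots are released from \<open>S\<close> to all fields one after the other:
  tensoriality in one slot needs the others only to be vector fields, so the slots not yet treated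
  may stay in \<open>S\<close>.\<close>

lemma curvature_action_eq_0:
  assumes span: "\<And>X. X \<in> vector_fields A \<Longrightarrow>
      \<exists>(I :: 'i set) a L. X = (\<Sum>i\<in>I. scale_field (a i) (L i)) \<and>
        (\<forall>i\<in>I. a i \<in> smooth_fun A \<and> L i \<in> S)"
    and S: "S \<subseteq> vector_fields A"
    and zero: "\<And>X Y U V W. X \<in> S \<Longrightarrow> Y \<in> S \<Longrightarrow> U \<in> S \<Longrightarrow> V \<in> S \<Longrightarrow> W \<in> S \<Longrightarrow>
      curvature_action (curvature D) X Y U V W = 0"
    and X: "X \<in> vector_fields A" "Y \<in> vector_fields A"
      "U \<in> vector_fields A" "V \<in> vector_fields A" "W \<in> vector_fields A"
  shows "curvature_action (curvature D) X Y U V W = 0"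
proof -
  have ext: "T X = 0" if T: "tensorial T" "\<And>L. L \<in> S \<Longrightarrow> T L = 0" and X: "X \<in> vector_fields A" for T X
  proof -
    obtain I :: "'i set" and a L where *: "X = (\<Sum>i\<in>I. scale_field (a i) (L i))"
      "\<And>i. i \<in> I \<Longrightarrow> a i \<in> smooth_fun A" "\<And>i. i \<in> I \<Longrightarrow> L i \<in> S"
      using span[OF X] by blast
    show ?thesis
      by (rule tensorial_eq_0[OF T(1) *(1)]) (use * T(2) S in auto)
  qed
  have "curvature_action (curvature D) X Y U V W = 0"
    if "Y \<in> S" "U \<in> S" "V \<in> S" "W \<in> S" "X \<in> vector_fields A" for X Y U V W
    by (rule ext[OF curvature_action_tensorial(1)]) (use that S zero in auto)
  then have "curvature_action (curvature D) X Y U V W = 0"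
    if "U \<in> S" "V \<in> S" "W \<in> S" "X \<in> vector_fields A" "Y \<in> vector_fields A" for X Y U V W
    by (rule_tac ext[OF curvature_action_tensorial(2)]) (use that S in auto)
  then have "curvature_action (curvature D) X Y U V W = 0"
    if "V \<in> S" "W \<in> S" "X \<in> vector_fields A" "Y \<in> vector_fields A" "U \<in> vector_fields A" for X Y U V W
    by (rule_tac ext[OF curvature_action_tensorial(3)]) (use that S in auto)
  then have "curvature_action (curvature D) X Y U V W = 0"
    if "W \<in> S" "X \<in> vector_fields A" "Y \<in> vector_fields A" "U \<in> vector_fields A"
      "V \<in> vector_fields A" for X Y U V W
    by (rule_tac ext[OF curvature_action_tensorial(4)]) (use that S in auto)
  then show ?thesis
    by (rule_tac ext[OF curvature_action_tensorial(5)]) (use X S in auto)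
qed

end

section \<open>Left invariant frames\<close>

context lie_group
begin

lemma in_carrier [simp]: "x \<in> carrier G"
  by (simp add: carrier_UNIV)

lemma smooth_manifold_A: "smooth_manifold A"
  by (rule smooth_manifold_axioms)

lemma smooth_manifold_prod: "smooth_manifold (prod_atlas A A)"
  using smooth_manifold_prod_atlas[OF smooth_manifold_A smooth_manifold_A] .

lemma smooth_fun_mult_prod:
  "f \<in> smooth_fun A \<Longrightarrow> (\<lambda>z. f (fst z \<otimes> snd z)) \<in> smooth_fun (prod_atlas A A)"
  using smooth_manifold.smooth_fun_compose[OF smooth_manifold_prod smooth_manifold_A smooth_mult]
  by (simp add: case_prod_unfold)

lemma smooth_fun_left_translate:
  assumes "f \<in> smooth_fun A"
  shows "(\<lambda>x. f (g \<otimes> x)) \<in> smooth_fun A"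
  using smooth_fun_compose[OF smooth_manifold_prod smooth_map_Pair[OF smooth_manifold_A
        smooth_manifold_A smooth_manifold_A smooth_map_const[OF smooth_manifold_A smooth_manifold_A]
        smooth_map_ident[OF smooth_manifold_A]] smooth_fun_mult_prod[OF assms]]
  by simp

text \<open>With \<open>f\<close> a coordinate function at the identity, the fibre derivatives of
  this function along a field are the coefficients of the field in the left invariant frame.\<close>

lemma smooth_fun_inverse_translate:
  assumes "f \<in> smooth_fun A"
  shows "(\<lambda>z. f (inv (fst z) \<otimes> snd z)) \<in> smooth_fun (prod_atlas A A)"
proof -
  have "smooth_map (prod_atlas A A) A (\<lambda>z. inv (fst z))"
    using smooth_map_compose[OF smooth_manifold_prod smooth_manifold_A smooth_manifold_A
        smooth_map_fst[OF smooth_manifold_A smooth_manifold_A] smooth_inv] .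
  from smooth_map_Pair[OF smooth_manifold_prod smooth_manifold_A smooth_manifold_A this
      smooth_map_snd[OF smooth_manifold_A smooth_manifold_A]]
  have "smooth_map (prod_atlas A A) (prod_atlas A A) (\<lambda>z. (inv (fst z), snd z))" .
  from smooth_manifold.smooth_fun_compose[OF smooth_manifold_prod smooth_manifold_prod this
      smooth_fun_mult_prod[OF assms]]
  show ?thesis by simp
qed

lemma differential_left_translate:
  assumes v: "v \<in> tangent_space A p"
  shows "differential A (\<lambda>x. g \<otimes> x) v \<in> tangent_space A (g \<otimes> p)"
proof (rule tangent_spaceI)
  fix f h assume fh: "f \<in> smooth_fun A" "h \<in> smooth_fun A"
  note sm = smooth_fun_left_translate[OF fh(1), of g] smooth_fun_left_translate[OF fh(2), of g]
  show "differential A (\<lambda>x. g \<otimes> x) v (\<lambda>x. f x + h x) =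
      differential A (\<lambda>x. g \<otimes> x) v f + differential A (\<lambda>x. g \<otimes> x) v h"
    using tangent_add[OF v sm] fh by (simp add: differential_def o_def smooth_fun_add)
  show "differential A (\<lambda>x. g \<otimes> x) v (\<lambda>x. f x * h x) =
      differential A (\<lambda>x. g \<otimes> x) v f * h (g \<otimes> p) + f (g \<otimes> p) * differential A (\<lambda>x. g \<otimes> x) v h"
    using tangent_mult[OF v sm] fh by (simp add: differential_def o_def smooth_fun_mult)
next
  fix f c assume f: "f \<in> smooth_fun A"
  show "differential A (\<lambda>x. g \<otimes> x) v (\<lambda>x. c * f x) = c * differential A (\<lambda>x. g \<otimes> x) v f"
    using tangent_scale[OF v smooth_fun_left_translate[OF f]] f
    by (simp add: differential_def o_def smooth_fun_mult smooth_fun_const)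
qed (simp add: differential_def)

lemma left_inv_field_apply:
  "f \<in> smooth_fun A \<Longrightarrow> left_inv_field A G u g f = u (\<lambda>x. f (g \<otimes> x))"
  by (simp add: left_inv_field_def differential_def o_def)

text \<open>Smoothness of \<open>g \<mapsto> u (x \<mapsto> f (g x))\<close> is the case of a fibre
  derivative with constant base point \<open>\<one>\<close> and constant vector
  \<open>u\<close>.\<close>

lemma left_inv_field_in_vector_fields:
  assumes u: "u \<in> tangent_space A \<one>"
  shows "left_inv_field A G u \<in> vector_fields A"
proof (rule vector_fieldsI)
  show "left_inv_field A G u g \<in> tangent_space A g" for g
    using differential_left_translate[OF u, of g] by (simp add: left_inv_field_def)
  fix f assume f: "f \<in> smooth_fun A"
  have "(\<lambda>g. u (\<lambda>x. f (fst (g, x) \<otimes> snd (g, x)))) \<in> smooth_fun A"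
    by (rule smooth_fun_fibre_derivative[OF smooth_manifold_A smooth_manifold_A
          smooth_map_const[OF smooth_manifold_A smooth_manifold_A] u smooth_fun_const
          smooth_fun_mult_prod[OF f]])
  then show "(\<lambda>g. left_inv_field A G u g f) \<in> smooth_fun A"
    using f by (simp add: left_inv_field_apply)
qed

lemma left_inv_field_translate:
  assumes "f \<in> smooth_fun A"
  shows "left_inv_field A G u (g \<otimes> x) f = left_inv_field A G u x (\<lambda>y. f (g \<otimes> y))"
  using assms by (simp add: left_inv_field_apply smooth_fun_left_translate m_assoc)

lemma lie_bracket_left_inv_fields:
  assumes u: "u \<in> tangent_space A \<one>" and v: "v \<in> tangent_space A \<one>"
  defines "w \<equiv> lie_bracket (left_inv_field A G u) (left_inv_field A G v) \<one>"
  shows "lie_bracket (left_inv_field A G u) (left_inv_field A G v) = left_inv_field A G w"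
    and "w \<in> tangent_space A \<one>"
proof -
  note fields = left_inv_field_in_vector_fields[OF u] left_inv_field_in_vector_fields[OF v]
  show w: "w \<in> tangent_space A \<one>"
    unfolding w_def by (intro vector_field_tangent vector_fields_lie_bracket fields)
  show "lie_bracket (left_inv_field A G u) (left_inv_field A G v) = left_inv_field A G w"
  proof (rule vfield_eqI)
    fix p f assume f: "f \<in> smooth_fun A"
    \<comment> \<open>Left translation by \<open>p\<close> moves the iterated derivative to the
      identity: the inner field by its translation law, the outer one by definition. Applied to both
      orders, it shows that the bracket is determined by its value \<open>w\<close> at the
      identity.\<close>
    have "left_inv_field A G u p (\<lambda>q. left_inv_field A G v q f) =
        left_inv_field A G u \<one> (\<lambda>q. left_inv_field A G v q (\<lambda>y. f (p \<otimes> y)))"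
      if v: "v \<in> tangent_space A \<one>" for u v
    proof -
      note v' = left_inv_field_in_vector_fields[OF v]
      show ?thesis
        using vector_field_smooth[OF v' f]
          vector_field_smooth[OF v' smooth_fun_left_translate[OF f, of p]]
        by (simp add: left_inv_field_apply[of "\<lambda>q. left_inv_field A G v q _"]
            left_inv_field_translate[OF f])
    qed
    from this[OF u] this[OF v]
    show "lie_bracket (left_inv_field A G u) (left_inv_field A G v) p f = left_inv_field A G w p f"
      by (subst left_inv_field_apply[OF f, of w]) (simp add: w_def lie_bracket_def)
  qed (intro vector_fields_lie_bracket fields left_inv_field_in_vector_fields w)+
qed

lemma lie_bracket_left_inv_fields_closed:
  assumes "X \<in> left_inv_field A G ` tangent_space A \<one>" "Y \<in> left_inv_field A G ` tangent_space A \<one>"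
  shows "lie_bracket X Y \<in> left_inv_field A G ` tangent_space A \<one>"
proof -
  obtain u v where "X = left_inv_field A G u" "u \<in> tangent_space A \<one>"
    "Y = left_inv_field A G v" "v \<in> tangent_space A \<one>"
    using assms by blast
  then show ?thesis
    using lie_bracket_left_inv_fields[of u v] by (metis imageI)
qed

text \<open>The coordinate expansion at the identity, regrouped: the \<open>\<epsilon> b\<close> are
  the partial derivatives in a chart, and the coefficients have become values of \<open>u\<close> on
  fixed smooth functions, which can be composed with left translations.\<close>

lemma tangent_space_one_basis:
  obtains B :: "'e set" and \<zeta> \<epsilon> where "\<And>b. \<zeta> b \<in> smooth_fun A" "\<And>b. \<epsilon> b \<in> tangent_space A \<one>"
    and "\<And>u f. u \<in> tangent_space A \<one> \<Longrightarrow> f \<in> smooth_fun A \<Longrightarrow> u f = (\<Sum>b\<in>B. u (\<zeta> b) * \<epsilon> b f)"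
proof -
  obtain B :: "'e set" where B: "parseval_frame B" by (rule frame_exists)
  obtain U \<phi> where U: "(U, \<phi>) \<in> A" "\<one> \<in> U" by (rule chart_at)
  let ?d = "\<lambda>f. frechet_derivative (\<lambda>x. f (inv_into U \<phi> x)) (at (\<phi> \<one>))"
  obtain W \<beta> \<xi> where W: "\<one> \<in> W" and \<beta>\<xi>: "\<beta> \<in> smooth_fun A" "\<And>b. \<xi> b \<in> smooth_fun A"
    and coord: "\<And>q v f. q \<in> W \<Longrightarrow> v \<in> tangent_space A q \<Longrightarrow> f \<in> smooth_fun A \<Longrightarrow>
      v f = (\<Sum>b\<in>B. (v (\<xi> b) - (\<phi> q \<bullet> b) * v \<beta>) / \<beta> q *
        frechet_derivative (\<lambda>x. f (inv_into U \<phi> x)) (at (\<phi> q)) b)"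
    by (rule tangent_vector_coordinates[OF B U]) blast
  \<comment> \<open>Normalised so that, by linearity of \<open>u\<close>,
    \<open>u (\<zeta> b)\<close> is exactly the coefficient of the partial derivative in
    \<open>tangent_vector_coordinates\<close>.\<close>
  define \<zeta> where "\<zeta> b x = inverse (\<beta> \<one>) * (\<xi> b x - (\<phi> \<one> \<bullet> b) * \<beta> x)" for b x
  \<comment> \<open>The value \<open>0\<close> off smooth functions is the convention of
    \<open>tangent_space\<close>.\<close>
  define \<epsilon> where "\<epsilon> b f = (if f \<in> smooth_fun A then ?d f b else 0)" for b f
  have sm: "(\<lambda>x. \<xi> b x - (\<phi> \<one> \<bullet> b) * \<beta> x) \<in> smooth_fun A" for b
    by (intro smooth_fun_intros \<beta>\<xi>)
  have \<zeta>: "\<zeta> b \<in> smooth_fun A" for b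
    unfolding \<zeta>_def by (intro smooth_fun_mult[OF smooth_fun_const sm])
  have deriv: "((\<lambda>x. f (inv_into U \<phi> x)) has_derivative ?d f) (at (\<phi> \<one>))" if "f \<in> smooth_fun A" for f
    using smooth_on_imp_has_derivative[OF smooth_funD[OF that U(1)]] U(2) by blast
  have \<epsilon>: "\<epsilon> b \<in> tangent_space A \<one>" for b
  proof (rule tangent_spaceI)
    fix f g assume fg: "f \<in> smooth_fun A" "g \<in> smooth_fun A"
    have "?d (\<lambda>x. f x + g x) = (\<lambda>b. ?d f b + ?d g b)"
      by (rule frechet_derivative_at[symmetric]) (intro has_derivative_add deriv fg)
    then show "\<epsilon> b (\<lambda>x. f x + g x) = \<epsilon> b f + \<epsilon> b g"
      using fg by (simp add: \<epsilon>_def smooth_fun_add)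
    have "?d (\<lambda>x. f x * g x) = (\<lambda>b. f (inv_into U \<phi> (\<phi> \<one>)) * ?d g b + ?d f b * g (inv_into U \<phi> (\<phi> \<one>)))"
      by (rule frechet_derivative_at[symmetric]) (intro has_derivative_mult deriv fg)
    then show "\<epsilon> b (\<lambda>x. f x * g x) = \<epsilon> b f * g \<one> + f \<one> * \<epsilon> b g"
      using fg U by (simp add: \<epsilon>_def smooth_fun_mult)
  next
    fix f c assume f: "f \<in> smooth_fun A"
    have "?d (\<lambda>x. c * f x) = (\<lambda>b. c * ?d f b)"
      by (rule frechet_derivative_at[symmetric]) (intro has_derivative_mult_right deriv f)
    then show "\<epsilon> b (\<lambda>x. c * f x) = c * \<epsilon> b f"
      using f by (simp add: \<epsilon>_def smooth_fun_mult smooth_fun_const)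
  qed (simp add: \<epsilon>_def)
  have "u f = (\<Sum>b\<in>B. u (\<zeta> b) * \<epsilon> b f)" if u: "u \<in> tangent_space A \<one>" and f: "f \<in> smooth_fun A" for u f
  proof -
    have "u (\<zeta> b) = (u (\<xi> b) - (\<phi> \<one> \<bullet> b) * u \<beta>) / \<beta> \<one>" for b
      unfolding \<zeta>_def tangent_scale[OF u sm]
        tangent_diff[OF u \<beta>\<xi>(2) smooth_fun_mult[OF smooth_fun_const \<beta>\<xi>(1)]]
        tangent_scale[OF u \<beta>\<xi>(1)] by (simp add: divide_inverse mult.commute)
    then show ?thesis using coord[OF W u f] f by (simp add: \<epsilon>_def)
  qed
  with \<zeta> \<epsilon> show thesis by (rule that)
qed

text \<open>The vector \<open>X g\<close> is carried to the identity by left multiplication with the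
  inverse of \<open>g\<close>, expanded there in the \<open>\<epsilon> b\<close>, and carried back,
  where each \<open>\<epsilon> b\<close> becomes the value at \<open>g\<close> of a left invariant
  field.\<close>

lemma vector_field_left_inv_frame:
  assumes X: "X \<in> vector_fields A"
  shows "\<exists>(I :: 'e set) a L. X = (\<Sum>i\<in>I. scale_field (a i) (L i)) \<and>
    (\<forall>i\<in>I. a i \<in> smooth_fun A \<and> L i \<in> left_inv_field A G ` tangent_space A \<one>)"
proof -
  obtain B :: "'e set" and \<zeta> \<epsilon> where \<zeta>: "\<And>b. \<zeta> b \<in> smooth_fun A"
    and \<epsilon>: "\<And>b. \<epsilon> b \<in> tangent_space A \<one>"
    and basis: "\<And>u f. u \<in> tangent_space A \<one> \<Longrightarrow> f \<in> smooth_fun A \<Longrightarrow> u f = (\<Sum>b\<in>B. u (\<zeta> b) * \<epsilon> b f)"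
    by (rule tangent_space_one_basis) blast
  define a where "a b g = X g (\<lambda>x. \<zeta> b (inv g \<otimes> x))" for b g
  have a: "a b \<in> smooth_fun A" for b
  proof -
    have "(\<lambda>g. X g (\<lambda>x. \<zeta> b (inv (fst (g, x)) \<otimes> snd (g, x)))) \<in> smooth_fun A"
      by (rule smooth_fun_fibre_derivative[OF smooth_manifold_A smooth_manifold_A
            smooth_map_ident[OF smooth_manifold_A] vector_field_tangent[OF X]
            vector_field_smooth[OF X] smooth_fun_inverse_translate[OF \<zeta>]])
    then show ?thesis by (simp add: a_def[abs_def])
  qed
  have sum_apply: "(\<Sum>b\<in>C. scale_field (a b) (left_inv_field A G (\<epsilon> b))) g f =
      (\<Sum>b\<in>C. a b g * left_inv_field A G (\<epsilon> b) g f)" for C g f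
    by (induction C rule: infinite_finite_induct) (simp_all add: scale_field_def)
  have "X = (\<Sum>b\<in>B. scale_field (a b) (left_inv_field A G (\<epsilon> b)))"
  proof (rule vfield_eqI[OF X])
    show "(\<Sum>b\<in>B. scale_field (a b) (left_inv_field A G (\<epsilon> b))) \<in> vector_fields A"
      by (intro vector_fields_sum vector_fields_scale a left_inv_field_in_vector_fields \<epsilon>)
    fix g f assume f: "f \<in> smooth_fun A"
    define w where "w = differential A (\<lambda>x. inv g \<otimes> x) (X g)"
    have w: "w \<in> tangent_space A \<one>"
      using differential_left_translate[OF vector_field_tangent[OF X], of "inv g" g]
      by (simp add: w_def l_inv)
    have w_apply: "w h = X g (\<lambda>x. h (inv g \<otimes> x))" if "h \<in> smooth_fun A" for h
      using that by (simp add: w_def differential_def o_def)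
    note gf = smooth_fun_left_translate[OF f, of g]
    have "X g f = w (\<lambda>x. f (g \<otimes> x))"
      by (simp add: w_apply[OF gf] r_inv flip: m_assoc)
    also have "\<dots> = (\<Sum>b\<in>B. a b g * left_inv_field A G (\<epsilon> b) g f)"
      by (simp add: basis[OF w gf] w_apply[OF \<zeta>] a_def left_inv_field_apply[OF f])
    finally show "X g f = (\<Sum>b\<in>B. scale_field (a b) (left_inv_field A G (\<epsilon> b))) g f"
      by (simp add: sum_apply)
  qed
  with a \<epsilon> show ?thesis
    by (intro exI[of _ B] exI[of _ a] exI[of _ "\<lambda>b. left_inv_field A G (\<epsilon> b)"]) simp
qed

section \<open>Curvature of the canonical connection on left invariant fields\<close>

lemma curvature_nabla0:
  assumes D0: "is_nabla0 A G D0"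
    and S: "S = left_inv_field A G ` tangent_space A \<one>"
    and X: "X \<in> S" "Y \<in> S" "Z \<in> S"
  shows "curvature D0 X Y Z = scale_field (\<lambda>_. - 1/4) (lie_bracket (lie_bracket X Y) Z)"
proof -
  interpret manifold_connection A D0
    using D0 by unfold_locales (simp add: is_nabla0_def)
  have VF: "V \<in> vector_fields A" if "V \<in> S" for V
    using that left_inv_field_in_vector_fields by (auto simp: S)
  have br: "lie_bracket V W \<in> S" if "V \<in> S" "W \<in> S" for V W
    using that lie_bracket_left_inv_fields_closed by (simp add: S)
  \<comment> \<open>Brackets of fields in \<open>S\<close> lie in \<open>S\<close>, so the formula
    can be applied a second time, to the outer derivative, once the constant \<open>1/2\<close> has
    been pulled through \<open>D0\<close>.\<close>
  have half: "D0 V W = scale_field (\<lambda>_. 1/2) (lie_bracket V W)" if "V \<in> S" "W \<in> S" for V W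
    using that D0 by (auto simp: S is_nabla0_def)
  have "curvature D0 X Y Z =
      scale_field (\<lambda>_. 1/2) (scale_field (\<lambda>_. 1/2) (lie_bracket X (lie_bracket Y Z)))
      - scale_field (\<lambda>_. 1/2) (scale_field (\<lambda>_. 1/2) (lie_bracket Y (lie_bracket X Z)))
      - scale_field (\<lambda>_. 1/2) (lie_bracket (lie_bracket X Y) Z)"
    using X by (simp add: curvature_def half br VF D_scale_const_right)
  \<comment> \<open>By Jacobi the first two terms combine to one quarter of
    \<open>[[X, Y], Z]\<close>, and the last one subtracts a half.\<close>
  also have "\<dots> = scale_field (\<lambda>_. - 1/4) (lie_bracket (lie_bracket X Y) Z)"
    unfolding lie_bracket_jacobi[OF VF[OF X(1)] VF[OF X(2)] VF[OF X(3)]]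
    by (simp add: scale_field_def fun_eq_iff field_simps)
  finally show ?thesis .
qed

lemma curvature_action_nabla0:
  assumes D0: "is_nabla0 A G D0"
    and S: "S = left_inv_field A G ` tangent_space A \<one>"
    and X: "X \<in> S" "Y \<in> S" "U \<in> S" "V \<in> S" "W \<in> S"
  shows "curvature_action (curvature D0) X Y U V W = 0"
proof -
  interpret manifold_connection A D0
    using D0 by unfold_locales (simp add: is_nabla0_def)
  have VF: "V \<in> vector_fields A" if "V \<in> S" for V
    using that left_inv_field_in_vector_fields by (auto simp: S)
  have br: "lie_bracket V W \<in> S" if "V \<in> S" "W \<in> S" for V W
    using that lie_bracket_left_inv_fields_closed by (simp add: S)
  note K = curvature_nabla0[OF D0 S]
  define Z where "Z = lie_bracket X Y"
  have Z: "Z \<in> S" using X br by (simp add: Z_def)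
  \<comment> \<open>Jacobi used twice: bracketing with \<open>Z\<close> is a derivation of the
    triple bracket \<open>[[U, V], W]\<close>. Each of the four curvature terms of
    \<open>curvature_action\<close> carries the factor \<open>1/16\<close>, so this identity is
    their cancellation.\<close>
  have "lie_bracket Z (lie_bracket (lie_bracket U V) W) =
      lie_bracket (lie_bracket (lie_bracket Z U) V) W + lie_bracket (lie_bracket U (lie_bracket Z V)) W
      + lie_bracket (lie_bracket U V) (lie_bracket Z W)"
    using X Z by (simp add: lie_bracket_jacobi[of Z "lie_bracket U V" W] lie_bracket_jacobi[of Z U V]
        lie_bracket_add_left br VF)
  then show ?thesis
    using X Z by (simp add: curvature_action_def K br VF smooth_fun_const curvature_scale_1
        curvature_scale_2 curvature_scale_3 flip: Z_def)
      (simp add: scale_field_def fun_eq_iff add_divide_distrib diff_divide_distrib)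
qed

end

theorem proposition2p1:
  fixes A :: "('a::{t2_space,second_countable_topology}, 'e::real_inner) atlas"
    and G :: "('a, 'm) monoid_scheme"
    and D :: "'a connection"
  assumes "lie_group A G"
    and "connected (UNIV :: 'a set)"
    and "special_connection A G D"
  shows "semi_symmetric A D"
proof -
  interpret lie_group A G by fact
  obtain D0 where D: "linear_connection A D" and D0: "is_nabla0 A G D0"
    and K: "\<And>X Y Z. X \<in> vector_fields A \<Longrightarrow> Y \<in> vector_fields A \<Longrightarrow> Z \<in> vector_fields A \<Longrightarrow>
      curvature D X Y Z = curvature D0 X Y Z"
    using assms(3) by (auto simp: special_connection_def)
  interpret D: manifold_connection A D using D by unfold_locales
  interpret D0: manifold_connection A D0 using D0 by unfold_locales (simp add: is_nabla0_def)
  let ?S = "left_inv_field A G ` tangent_space A \<one>\<^bsub>G\<^esub>"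
  have "curvature_action (curvature D) X Y U V W = 0"
    if X: "X \<in> vector_fields A" "Y \<in> vector_fields A"
      "U \<in> vector_fields A" "V \<in> vector_fields A" "W \<in> vector_fields A" for X Y U V W
  proof -
    have "curvature_action (curvature D0) X Y U V W = 0"
    proof (rule D0.curvature_action_eq_0[where S = ?S, OF vector_field_left_inv_frame])
      show "?S \<subseteq> vector_fields A" using left_inv_field_in_vector_fields by blast
    qed (use X curvature_action_nabla0[OF D0 refl] in auto)
    \<comment> \<open>The two curvatures are known to agree on vector fields only, so
      \<open>curvature_closed\<close> must certify the inner curvatures before the outer ones can be
      rewritten.\<close>
    then show ?thesis
      using X by (simp add: curvature_action_def K D0.curvature_closed)
  qed
  \<comment> \<open>Terms with derivatives at two different places occur symmetrically in
    \<open>X\<close> and \<open>Y\<close> and cancel; the others assemble into curvatures. As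
    \<open>curvature\<close> is unfolded on both sides, the curvatures inserted into
    \<open>K\<close> have to be split by additivity, also inside brackets, whence
    \<open>lie_bracket_diff\<close>.\<close>
  moreover have ricci: "(cov_deriv D X (cov_deriv D Y (curvature D)) - cov_deriv D Y (cov_deriv D X (curvature D))
      - cov_deriv D (lie_bracket X Y) (curvature D)) U V W = curvature_action (curvature D) X Y U V W"
    if "X \<in> vector_fields A" "Y \<in> vector_fields A"
      "U \<in> vector_fields A" "V \<in> vector_fields A" "W \<in> vector_fields A" for X Y U V W
    using that
    by (simp add: curvature_action_def cov_deriv_def curvature_def D.D_diff_left D.D_diff_right
        D.D_closed vector_fields_diff vector_fields_lie_bracket lie_bracket_diff)
  ultimately show ?thesis
    unfolding semi_symmetric_def Let_def by (intro ballI) (simp only: ricci)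
qed

end
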